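(* Let $R>0$ and let $u\in C^4(B_R(0))$, $B_R(0)\subset\mathbb{R}^2$, be a convex solution of the Monge–Ampère equation $$\det D^2u=f(x)\quad\text{in } B_R(0),$$ where $f$ is a $C^2$ function satisfying $0<m\le f\le M$ in $B_R(0)$ for constants $0<m\le M$. Then $$|D^2u(0)|\le C_1\exp\Big(C_2\,\frac{\sup_{B_R(0)}|Du|^2}{R^2}\Big),$$ where $C_1>0$ depends only on $m$, $M$, $R\sup_{B_R(0)}|\nabla f|$ and $R^2\sup_{B_R(0)}|\nabla^2 f|$, and $C_2>0$ depends only on $m$ and $M$.
   Context: $|D^2u(0)|$ denotes a norm of the Hessian matrix at the origin (e.g. its largest eigenvalue, which for convex $u$ controls all entries). *)

theory Defs
  imports "HOL-Analysis.Analysis"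
begin

text \<open>k-times continuously differentiable real-valued functions on a set S
  (intended for open S): C^0 = continuous; C^(k+1) = differentiable at every
  point of S with gradient field whose components are C^k.\<close>
fun Ck_on :: "nat \<Rightarrow> ('a::euclidean_space) set \<Rightarrow> ('a \<Rightarrow> real) \<Rightarrow> bool" where
  "Ck_on 0 S u = continuous_on S u"
| "Ck_on (Suc k) S u =
     (\<exists>g. (\<forall>x\<in>S. (u has_derivative (\<lambda>h. g x \<bullet> h)) (at x)) \<and>
          (\<forall>i\<in>Basis. Ck_on k S (\<lambda>x. g x \<bullet> i)))"

definition pd :: "2 \<Rightarrow> (real^2 \<Rightarrow> real) \<Rightarrow> real^2 \<Rightarrow> real" where
  "pd i u x = frechet_derivative u (at x) (axis i 1)"

definition grad :: "(real^2 \<Rightarrow> real) \<Rightarrow> real^2 \<Rightarrow> real^2" where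
  "grad u x = (\<chi> i. pd i u x)"

definition hess :: "(real^2 \<Rightarrow> real) \<Rightarrow> real^2 \<Rightarrow> real^2^2" where
  "hess u x = (\<chi> i j. pd j (pd i u) x)"

definition mat_norm :: "real^2^2 \<Rightarrow> real" where
  "mat_norm A = onorm (\<lambda>h. A *v h)"

end

theory Submission
  imports Defs
begin

text \<open>
  Bernstein technique with a cutoff adapted to the eigendirections of the Hessian. Rescale to
  radius \<open>r = R / 2\<close>, let \<open>\<tau>\<close> be a unit eigenvector of \<open>D\<^sup>2u(x)\<close> for the large eigenvalue \<open>\<lambda>\<close>, and maximise
  \<open>\<lambda> ((1 - y\<^sub>1\<^sup>2) (1 - y\<^sub>2\<^sup>2))\<^sup>2 exp (c |Du|\<^sup>2 / 2)\<close>, where \<open>y\<^sub>1 = x \<bullet> \<tau>\<close>, \<open>y\<^sub>2 = x \<bullet> \<tau>\<^sup>\<bottom>\<close> and \<open>c = 5 / m\<close>.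
  At the maximum apply the linearised operator \<open>\<mu> d\<^sub>1\<^sub>1 + \<lambda> d\<^sub>2\<^sub>2\<close> to the logarithm. The good third order
  term \<open>u\<^sub>1\<^sub>1\<^sub>2\<^sup>2 / \<lambda>\<close> becomes, by the first order condition, \<open>\<lambda>\<close> times the squared logarithmic derivative of
  the cutoff in \<open>y\<^sub>2\<close>, so the cutoff enters at order \<open>\<lambda>\<close> only through
  \<open>\<zeta>'' / \<zeta> \<ge> -4\<close> with \<open>\<zeta> = (1 - y\<^sub>2\<^sup>2)\<^sup>2\<close>. A radial cutoff would fail here, since its tangential second
  derivative is very negative near the boundary. The exponential contributes \<open>c f \<lambda> \<ge> 5 \<lambda>\<close>, and all other
  terms, including those from the rotation of \<open>\<tau>\<close>, have lower order. Hence the maximum is at most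
  \<open>1000 G\<^sup>2 exp (c K\<^sup>2 / 2)\<close>, where \<open>K\<close> is the rescaled gradient bound and \<open>G\<close> bounds the remaining data.
\<close>

section \<open>Directional derivatives of functions of class C^k\<close>

lemma Ck_on_cong:
  assumes "open S" "Ck_on k S f" "\<And>x. x \<in> S \<Longrightarrow> f x = g x"
  shows "Ck_on k S g"
proof (cases k)
  case 0
  then show ?thesis using assms by (auto cong: continuous_on_cong)
next
  case (Suc j)
  then obtain d where d: "\<forall>x\<in>S. (f has_derivative (\<lambda>h. d x \<bullet> h)) (at x)"
    "\<forall>i\<in>Basis. Ck_on j S (\<lambda>x. d x \<bullet> i)"
    using assms(2) by auto
  have "(g has_derivative (\<lambda>h. d x \<bullet> h)) (at x)" if "x \<in> S" for x
    using d(1) that assms has_derivative_transform_within_open[of f _ x UNIV S g] by auto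
  with d Suc show ?thesis by auto
qed

lemma Ck_on_lincomb:
  assumes "Ck_on k S f" "Ck_on k S g"
  shows "Ck_on k S (\<lambda>x. a * f x + b * g x)"
  using assms
proof (induction k arbitrary: f g)
  case 0
  then show ?case by (auto intro!: continuous_intros)
next
  case (Suc k)
  obtain d e where d: "\<forall>x\<in>S. (f has_derivative (\<lambda>h. d x \<bullet> h)) (at x)"
    "\<forall>i\<in>Basis. Ck_on k S (\<lambda>x. d x \<bullet> i)"
    and e: "\<forall>x\<in>S. (g has_derivative (\<lambda>h. e x \<bullet> h)) (at x)"
    "\<forall>i\<in>Basis. Ck_on k S (\<lambda>x. e x \<bullet> i)"
    using Suc.prems by auto
  have "((\<lambda>x. a * f x + b * g x) has_derivative (\<lambda>h. (a *\<^sub>R d x + b *\<^sub>R e x) \<bullet> h)) (at x)"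
    if "x \<in> S" for x
    using d(1) e(1) that by (auto intro!: derivative_eq_intros simp: inner_add_left)
  moreover have "Ck_on k S (\<lambda>x. (a *\<^sub>R d x + b *\<^sub>R e x) \<bullet> i)" if "i \<in> Basis" for i
    using Suc.IH[of "\<lambda>x. d x \<bullet> i" "\<lambda>x. e x \<bullet> i"] d(2) e(2) that by (simp add: inner_add_left)
  ultimately show ?case
    unfolding Ck_on.simps by (intro exI[of _ "\<lambda>x. a *\<^sub>R d x + b *\<^sub>R e x"]) auto
qed

lemma Ck_on_SucD:
  assumes "Ck_on (Suc k) S f"
  shows "Ck_on k S f"
  using assms
proof (induction k arbitrary: f)
  case 0
  then have "f differentiable (at x)" if "x \<in> S" for x
    using that unfolding differentiable_def by auto
  then show ?case
    by (auto intro!: continuous_at_imp_continuous_on differentiable_imp_continuous_within)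
next
  case (Suc k)
  from Suc.prems obtain d where d: "\<forall>x\<in>S. (f has_derivative (\<lambda>h. d x \<bullet> h)) (at x)"
    "\<forall>i\<in>Basis. Ck_on (Suc k) S (\<lambda>x. d x \<bullet> i)"
    unfolding Ck_on.simps(2)[of "Suc k"] by blast
  then have "\<forall>i\<in>Basis. Ck_on k S (\<lambda>x. d x \<bullet> i)"
    using Suc.IH by blast
  with d(1) show ?case
    unfolding Ck_on.simps(2)[of k] by blast
qed

lemma Ck_on_mono: "Ck_on k S f \<Longrightarrow> j \<le> k \<Longrightarrow> Ck_on j S f"
  by (induction k) (auto simp del: Ck_on.simps simp: le_Suc_eq dest: Ck_on_SucD)

lemma Ck_on_continuous_on: "Ck_on k S f \<Longrightarrow> continuous_on S f"
  using Ck_on_mono[of k S f 0] by simp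

lemma Ck_on_Suc_pd:
  fixes u :: "real^2 \<Rightarrow> real"
  assumes "open S" "Ck_on (Suc k) S u"
  shows Ck_on_has_derivative: "\<And>x. x \<in> S \<Longrightarrow> (u has_derivative (\<lambda>h. grad u x \<bullet> h)) (at x)"
    and Ck_on_pd: "Ck_on k S (pd i u)"
proof -
  obtain d where d: "\<forall>x\<in>S. (u has_derivative (\<lambda>h. d x \<bullet> h)) (at x)"
    "\<forall>i\<in>Basis. Ck_on k S (\<lambda>x. d x \<bullet> i)"
    using assms(2) by auto
  have pd: "d x \<bullet> axis i 1 = pd i u x" if "x \<in> S" for x i
    using frechet_derivative_at[of u _ x] d(1) that unfolding pd_def by metis
  then have "grad u x = d x" if "x \<in> S" for x
    using that by (simp add: grad_def vec_eq_iff inner_axis)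
  with d(1) show "\<And>x. x \<in> S \<Longrightarrow> (u has_derivative (\<lambda>h. grad u x \<bullet> h)) (at x)"
    by simp
  have "axis i (1::real) \<in> Basis" by (simp add: axis_in_Basis_iff)
  then show "Ck_on k S (pd i u)"
    using Ck_on_cong[OF assms(1) d(2)[rule_format, of "axis i 1"]] pd by auto
qed

text \<open>Built from the two partial derivatives, so that linearity in \<open>d\<close> is
  immediate and differentiability of order k is inherited from closure under linear
  combinations.\<close>

definition dird :: "real^2 \<Rightarrow> (real^2 \<Rightarrow> real) \<Rightarrow> real^2 \<Rightarrow> real" where
  "dird d w x = d $ 1 * pd 1 w x + d $ 2 * pd 2 w x"

lemma dird_eq_grad: "dird d w x = grad w x \<bullet> d"
  by (simp add: dird_def grad_def inner_vec_def sum_2)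

lemma Ck_on_dird:
  assumes "open S" "Ck_on (Suc k) S w"
  shows "Ck_on k S (dird d w)"
  using Ck_on_lincomb[OF Ck_on_pd[OF assms] Ck_on_pd[OF assms]] unfolding dird_def by simp

lemma has_derivative_imp_dird:
  assumes "(w has_derivative D) (at x)"
  shows "dird d w x = D d"
proof -
  have "linear D" using assms has_derivative_linear by blast
  then have "D (d $ 1 *\<^sub>R axis 1 1 + d $ 2 *\<^sub>R axis 2 1) = d $ 1 * D (axis 1 1) + d $ 2 * D (axis 2 1)"
    by (simp add: linear_add linear_scale)
  moreover have "d $ 1 *\<^sub>R axis 1 1 + d $ 2 *\<^sub>R axis 2 1 = d"
    by (simp add: vec_eq_iff forall_2 axis_def)
  ultimately have "D d = d $ 1 * D (axis 1 1) + d $ 2 * D (axis 2 1)"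
    by simp
  then show ?thesis
    unfolding dird_def pd_def using frechet_derivative_at[OF assms] by simp
qed

lemma dird_cong:
  assumes "open S" "Ck_on (Suc k) S f" "x \<in> S" "\<And>x. x \<in> S \<Longrightarrow> f x = g x"
  shows "dird d f x = dird d g x"
proof -
  have "(f has_derivative (\<lambda>h. grad f x \<bullet> h)) (at x)"
    using Ck_on_has_derivative assms by blast
  moreover from this have "(g has_derivative (\<lambda>h. grad f x \<bullet> h)) (at x)"
    using assms has_derivative_transform_within_open[of f _ x UNIV S g] by auto
  ultimately show ?thesis using has_derivative_imp_dird by metis
qed

lemma has_real_derivative_along_line:
  assumes "open S" "Ck_on (Suc k) S w" "x + t *\<^sub>R d \<in> S"
  shows "((\<lambda>t. w (x + t *\<^sub>R d)) has_real_derivative dird d w (x + t *\<^sub>R d)) (at t)"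
proof -
  have "(w has_derivative (\<lambda>h. grad w (x + t *\<^sub>R d) \<bullet> h)) (at (x + t *\<^sub>R d))"
    using Ck_on_has_derivative assms by blast
  then have "((\<lambda>t. w (x + t *\<^sub>R d)) has_derivative (\<lambda>h. grad w (x + t *\<^sub>R d) \<bullet> (h *\<^sub>R d))) (at t)"
    by (rule has_derivative_compose[rotated]) (auto intro!: derivative_eq_intros)
  moreover have "(\<lambda>h. grad w (x + t *\<^sub>R d) \<bullet> (h *\<^sub>R d)) = (*) (dird d w (x + t *\<^sub>R d))"
    by (auto simp: dird_eq_grad)
  ultimately show ?thesis
    by (simp add: has_field_derivative_def)
qed

text \<open>The second difference over a parallelogram is symmetric in \<open>a\<close> and
  \<open>b\<close>. The mean value theorem along \<open>a\<close>, then along \<open>b\<close>,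
  turns it into a mixed derivative in one prescribed order, which is what
  \<open>dird_commute\<close> needs.\<close>

lemma rectangle_mean_value:
  fixes w :: "real^2 \<Rightarrow> real"
  assumes S: "open S" and w: "Ck_on (Suc (Suc k)) S w" and h: "0 < h"
    and sub: "\<And>s t. 0 \<le> s \<Longrightarrow> s \<le> h \<Longrightarrow> 0 \<le> t \<Longrightarrow> t \<le> h \<Longrightarrow> x + s *\<^sub>R a + t *\<^sub>R b \<in> S"
  obtains s t where "0 < s" "s < h" "0 < t" "t < h"
    "w (x + h *\<^sub>R a + h *\<^sub>R b) - w (x + h *\<^sub>R a) - w (x + h *\<^sub>R b) + w x
      = h\<^sup>2 * dird b (dird a w) (x + s *\<^sub>R a + t *\<^sub>R b)"
proof -
  define F where "F = (\<lambda>s. w ((x + h *\<^sub>R b) + s *\<^sub>R a) - w (x + s *\<^sub>R a))"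
  have "(F has_real_derivative dird a w ((x + h *\<^sub>R b) + s *\<^sub>R a) - dird a w (x + s *\<^sub>R a)) (at s)"
    if "0 \<le> s" "s \<le> h" for s
    unfolding F_def
  proof (rule DERIV_diff)
    have "x + h *\<^sub>R b + s *\<^sub>R a \<in> S"
      using sub[OF that, of h] h by (simp add: add.commute add.left_commute)
    then show "((\<lambda>s. w ((x + h *\<^sub>R b) + s *\<^sub>R a)) has_real_derivative
        dird a w ((x + h *\<^sub>R b) + s *\<^sub>R a)) (at s)"
      by (rule has_real_derivative_along_line[OF S w])
    have "x + s *\<^sub>R a \<in> S"
      using sub[OF that, of 0] h by simp
    then show "((\<lambda>s. w (x + s *\<^sub>R a)) has_real_derivative dird a w (x + s *\<^sub>R a)) (at s)"
      by (rule has_real_derivative_along_line[OF S w])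
  qed
  then have "\<exists>s. 0 < s \<and> s < h \<and>
      F h - F 0 = (h - 0) * (dird a w ((x + h *\<^sub>R b) + s *\<^sub>R a) - dird a w (x + s *\<^sub>R a))"
    by (rule MVT2[OF h])
  then obtain s where s: "0 < s" "s < h"
    "F h - F 0 = (h - 0) * (dird a w ((x + h *\<^sub>R b) + s *\<^sub>R a) - dird a w (x + s *\<^sub>R a))"
    by blast
  define G where "G = (\<lambda>t. dird a w ((x + s *\<^sub>R a) + t *\<^sub>R b))"
  have "(G has_real_derivative dird b (dird a w) ((x + s *\<^sub>R a) + t *\<^sub>R b)) (at t)"
    if "0 \<le> t" "t \<le> h" for t
    unfolding G_def using sub[of s t] s that
    by (rule_tac has_real_derivative_along_line[OF S Ck_on_dird[OF S w]]) auto
  then have "\<exists>t. 0 < t \<and> t < h \<and>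
      G h - G 0 = (h - 0) * dird b (dird a w) ((x + s *\<^sub>R a) + t *\<^sub>R b)"
    by (rule MVT2[OF h])
  then obtain t where t: "0 < t" "t < h"
    "G h - G 0 = (h - 0) * dird b (dird a w) ((x + s *\<^sub>R a) + t *\<^sub>R b)"
    by blast
  have "F h - F 0 = h * (G h - G 0)"
    using s(3) by (simp add: G_def algebra_simps)
  then have "F h - F 0 = h\<^sup>2 * dird b (dird a w) (x + s *\<^sub>R a + t *\<^sub>R b)"
    using t(3) by (simp add: power2_eq_square)
  moreover have "F h - F 0 = w (x + h *\<^sub>R a + h *\<^sub>R b) - w (x + h *\<^sub>R a) - w (x + h *\<^sub>R b) + w x"
    by (simp add: F_def algebra_simps)
  ultimately show ?thesis using that s t by simp
qed

text \<open>Schwarz's theorem. By \<open>rectangle_mean_value\<close> in both orders, one mixed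
  derivative at some point of a small parallelogram equals the other one at a second point of it;
  different values at \<open>x\<close> would contradict continuity.\<close>

lemma dird_commute:
  fixes w :: "real^2 \<Rightarrow> real"
  assumes S: "open S" and w: "Ck_on (Suc (Suc k)) S w" and x: "x \<in> S"
  shows "dird a (dird b w) x = dird b (dird a w) x"
proof (rule ccontr)
  let ?A = "dird b (dird a w)" and ?B = "dird a (dird b w)"
  assume ne: "?B x \<noteq> ?A x"
  define e where "e = \<bar>?B x - ?A x\<bar> / 2"
  have e: "0 < e" using ne by (simp add: e_def)
  have "continuous_on S ?A" "continuous_on S ?B"
    by (intro Ck_on_continuous_on[OF Ck_on_dird[OF S Ck_on_dird[OF S w]]])+
  then have "isCont ?A x" "isCont ?B x"
    using S x by (auto simp: continuous_on_eq_continuous_at)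
  then obtain d1 d2 where d: "0 < d1" "\<And>y. dist y x < d1 \<Longrightarrow> \<bar>?A y - ?A x\<bar> < e"
    "0 < d2" "\<And>y. dist y x < d2 \<Longrightarrow> \<bar>?B y - ?B x\<bar> < e"
    unfolding continuous_at_eps_delta dist_real_def using e by metis
  obtain d3 where d3: "0 < d3" "ball x d3 \<subseteq> S"
    using S x openE by blast
  define r where "r = min d1 (min d2 d3)"
  \<comment> \<open>Small enough to keep the whole parallelogram within distance \<open>r\<close> of
    \<open>x\<close>; the summand 1 makes the denominator positive even if \<open>a\<close> and
    \<open>b\<close> vanish.\<close>
  define h where "h = r / (norm a + norm b + 1)"
  have r: "0 < r" using d d3 by (simp add: r_def)
  have pos: "0 < norm a + norm b + 1" by (smt (verit) norm_ge_zero)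
  have h: "0 < h" using r pos by (simp add: h_def)
  have near: "dist (x + s *\<^sub>R a + t *\<^sub>R b) x < r" if "0 \<le> s" "s \<le> h" "0 \<le> t" "t \<le> h" for s t
  proof -
    have "dist (x + s *\<^sub>R a + t *\<^sub>R b) x \<le> s * norm a + t * norm b"
      using that norm_triangle_ineq[of "s *\<^sub>R a" "t *\<^sub>R b"] by (simp add: dist_norm add.assoc)
    also have "\<dots> \<le> h * norm a + h * norm b"
      using that by (intro add_mono mult_right_mono) auto
    also have "\<dots> < h * (norm a + norm b + 1)"
      using h by (simp add: algebra_simps)
    also have "\<dots> = r" using pos by (simp add: h_def)
    finally show ?thesis .
  qed
  have sub: "x + s *\<^sub>R a + t *\<^sub>R b \<in> S" if "0 \<le> s" "s \<le> h" "0 \<le> t" "t \<le> h" for s t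
    using near[OF that] d3(2) by (auto simp: r_def dist_commute subset_iff)
  obtain s t where st: "0 < s" "s < h" "0 < t" "t < h"
    "w (x + h *\<^sub>R a + h *\<^sub>R b) - w (x + h *\<^sub>R a) - w (x + h *\<^sub>R b) + w x
      = h\<^sup>2 * ?A (x + s *\<^sub>R a + t *\<^sub>R b)"
    using rectangle_mean_value[OF S w h, where x = x and a = a and b = b] sub by blast
  have sub': "x + s *\<^sub>R b + t *\<^sub>R a \<in> S" if "0 \<le> s" "s \<le> h" "0 \<le> t" "t \<le> h" for s t
    using sub[of t s] that by (simp add: add.assoc add.commute[of "s *\<^sub>R b"])
  obtain s' t' where st': "0 < s'" "s' < h" "0 < t'" "t' < h"
    "w (x + h *\<^sub>R b + h *\<^sub>R a) - w (x + h *\<^sub>R b) - w (x + h *\<^sub>R a) + w x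
      = h\<^sup>2 * ?B (x + s' *\<^sub>R b + t' *\<^sub>R a)"
    using rectangle_mean_value[OF S w h, where x = x and a = b and b = a] sub' by blast
  have "h\<^sup>2 * ?A (x + s *\<^sub>R a + t *\<^sub>R b) = h\<^sup>2 * ?B (x + s' *\<^sub>R b + t' *\<^sub>R a)"
    using st(5) st'(5) by (simp add: algebra_simps)
  then have eq: "?A (x + s *\<^sub>R a + t *\<^sub>R b) = ?B (x + t' *\<^sub>R a + s' *\<^sub>R b)"
    using h by (simp add: algebra_simps)
  have "\<bar>?A (x + s *\<^sub>R a + t *\<^sub>R b) - ?A x\<bar> < e"
    using near[of s t] st d(2) by (simp add: r_def)
  moreover have "\<bar>?B (x + t' *\<^sub>R a + s' *\<^sub>R b) - ?B x\<bar> < e"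
    using near[of t' s'] st' d(4) by (simp add: r_def)
  ultimately show False
    using eq unfolding e_def by (smt (verit) field_sum_of_halves)
qed

section \<open>Two-jets of functions of one variable\<close>

text \<open>The first derivative is required near 0, the second only at 0, which is all the second
  derivative test needs. Jets of composite functions are then assembled rule by rule instead of
  differentiating one large expression.\<close>

definition jet2 :: "(real \<Rightarrow> real) \<Rightarrow> real \<Rightarrow> real \<Rightarrow> real \<Rightarrow> bool" where
  "jet2 f a b c \<longleftrightarrow> (\<exists>f'. f 0 = a \<and> f' 0 = b \<and>
     (\<forall>\<^sub>F t in nhds 0. (f has_real_derivative f' t) (at t)) \<and> (f' has_real_derivative c) (at 0))"

lemma jet2I:
  assumes "\<forall>\<^sub>F t in nhds 0. (f has_real_derivative f' t) (at t)" "(f' has_real_derivative c) (at 0)"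
    "f 0 = a" "f' 0 = b"
  shows "jet2 f a b c"
  using assms unfolding jet2_def by blast

lemma jet2_value: "jet2 f a b c \<Longrightarrow> f 0 = a"
  by (auto simp: jet2_def)

lemma jet2_derivative: "jet2 f a b c \<Longrightarrow> (f has_real_derivative b) (at 0)"
  by (auto simp: jet2_def dest: eventually_nhds_x_imp_x)

lemma jet2_tendsto: "jet2 f a b c \<Longrightarrow> (f \<longlongrightarrow> a) (nhds 0)"
  using jet2_derivative[THEN DERIV_isCont] jet2_value
  by (metis isCont_def tendsto_at_iff_tendsto_nhds)

lemma jet2_eq: "jet2 f a b c \<Longrightarrow> a = a' \<Longrightarrow> b = b' \<Longrightarrow> c = c' \<Longrightarrow> jet2 f a' b' c'"
  by simp

lemma jet2_cong:
  assumes "jet2 f a b c" "\<forall>\<^sub>F t in nhds 0. f t = g t"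
  shows "jet2 g a b c"
proof -
  obtain f' where f: "f 0 = a" "f' 0 = b" "\<forall>\<^sub>F t in nhds 0. (f has_real_derivative f' t) (at t)"
      "(f' has_real_derivative c) (at 0)"
    using assms(1) unfolding jet2_def by blast
  \<comment> \<open>Equality near 0 is also equality near each \<open>t\<close> close to 0, so the
    derivatives at those \<open>t\<close> agree as well.\<close>
  have "\<forall>\<^sub>F t in nhds 0. \<forall>\<^sub>F s in nhds t. f s = g s"
    using assms(2) unfolding eventually_eventually .
  with f(3) have "\<forall>\<^sub>F t in nhds 0. (g has_real_derivative f' t) (at t)"
    by eventually_elim (use DERIV_cong_ev in blast)
  then show ?thesis
    using f eventually_nhds_x_imp_x[OF assms(2)] unfolding jet2_def by auto
qed

lemma jet2_affine: "jet2 (\<lambda>t. x + k * t) x k 0"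
  by (rule jet2I[where f' = "\<lambda>_. k"]) (auto intro!: derivative_eq_intros always_eventually)

lemma jet2_const: "jet2 (\<lambda>t. x) x 0 0"
  using jet2_affine[of x 0] by simp

lemma jet2_add:
  assumes "jet2 f a b c" "jet2 g a' b' c'"
  shows "jet2 (\<lambda>t. f t + g t) (a + a') (b + b') (c + c')"
proof -
  obtain f' g' where f: "f 0 = a" "f' 0 = b" "\<forall>\<^sub>F t in nhds 0. (f has_real_derivative f' t) (at t)"
      "(f' has_real_derivative c) (at 0)"
    and g: "g 0 = a'" "g' 0 = b'" "\<forall>\<^sub>F t in nhds 0. (g has_real_derivative g' t) (at t)"
      "(g' has_real_derivative c') (at 0)"
    using assms unfolding jet2_def by blast
  show ?thesis
  proof (rule jet2I)
    show "\<forall>\<^sub>F t in nhds 0. ((\<lambda>t. f t + g t) has_real_derivative f' t + g' t) (at t)"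
      using f(3) g(3) by eventually_elim (rule DERIV_add)
    show "((\<lambda>t. f' t + g' t) has_real_derivative c + c') (at 0)"
      using f(4) g(4) by (rule DERIV_add)
  qed (use f g in auto)
qed

lemma jet2_mult:
  assumes "jet2 f a b c" "jet2 g a' b' c'"
  shows "jet2 (\<lambda>t. f t * g t) (a * a') (b * a' + a * b') (c * a' + 2 * b * b' + a * c')"
proof -
  obtain f' g' where f: "f 0 = a" "f' 0 = b" "\<forall>\<^sub>F t in nhds 0. (f has_real_derivative f' t) (at t)"
      "(f' has_real_derivative c) (at 0)"
    and g: "g 0 = a'" "g' 0 = b'" "\<forall>\<^sub>F t in nhds 0. (g has_real_derivative g' t) (at t)"
      "(g' has_real_derivative c') (at 0)"
    using assms unfolding jet2_def by blast
  have f0: "(f has_real_derivative b) (at 0)" and g0: "(g has_real_derivative b') (at 0)"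
    using jet2_derivative assms by auto
  show ?thesis
  proof (rule jet2I)
    show "\<forall>\<^sub>F t in nhds 0. ((\<lambda>t. f t * g t) has_real_derivative f' t * g t + f t * g' t) (at t)"
      using f(3) g(3) by eventually_elim (auto intro!: derivative_eq_intros)
    show "((\<lambda>t. f' t * g t + f t * g' t) has_real_derivative c * a' + 2 * b * b' + a * c') (at 0)"
      using f(4) g(4) f0 g0 f(1,2) g(1,2) by (auto intro!: derivative_eq_intros simp: algebra_simps)
  qed (use f g in auto)
qed

lemma jet2_cmult: "jet2 f a b c \<Longrightarrow> jet2 (\<lambda>t. k * f t) (k * a) (k * b) (k * c)"
  by (rule jet2_eq[OF jet2_mult[OF jet2_const]]) auto

lemma jet2_diff:
  assumes "jet2 f a b c" "jet2 g a' b' c'"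
  shows "jet2 (\<lambda>t. f t - g t) (a - a') (b - b') (c - c')"
  using jet2_add[OF assms(1) jet2_cmult[OF assms(2), of "-1"]] by simp

lemma jet2_power2:
  assumes "jet2 f a b c"
  shows "jet2 (\<lambda>t. (f t)\<^sup>2) (a\<^sup>2) (2 * a * b) (2 * b\<^sup>2 + 2 * a * c)"
  using jet2_mult[OF assms assms] by (simp add: power2_eq_square algebra_simps)

lemma jet2_compose:
  assumes "jet2 f a b c" and g: "\<forall>\<^sub>F y in nhds a. (g has_real_derivative g' y) (at y)"
    "(g' has_real_derivative g2) (at a)"
  shows "jet2 (\<lambda>t. g (f t)) (g a) (g' a * b) (g2 * b\<^sup>2 + g' a * c)"
proof -
  obtain f' where f: "f 0 = a" "f' 0 = b" "\<forall>\<^sub>F t in nhds 0. (f has_real_derivative f' t) (at t)"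
      "(f' has_real_derivative c) (at 0)"
    using assms(1) unfolding jet2_def by blast
  have f0: "(f has_real_derivative b) (at 0)"
    using jet2_derivative assms(1) by auto
  have "\<forall>\<^sub>F t in nhds 0. (g has_real_derivative g' (f t)) (at (f t))"
    using jet2_tendsto[OF assms(1)] g(1) unfolding filterlim_iff by blast
  show ?thesis
  proof (rule jet2I)
    show "\<forall>\<^sub>F t in nhds 0. ((\<lambda>t. g (f t)) has_real_derivative g' (f t) * f' t) (at t)"
      using \<open>\<forall>\<^sub>F t in nhds 0. (g has_real_derivative g' (f t)) (at (f t))\<close> f(3)
      by eventually_elim (rule DERIV_chain2)
    have "((\<lambda>t. g' (f t)) has_real_derivative g2 * b) (at 0)"
      using DERIV_chain2[of g' g2 f 0 b UNIV] g(2) f0 f(1) by simp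
    then show "((\<lambda>t. g' (f t) * f' t) has_real_derivative g2 * b\<^sup>2 + g' a * c) (at 0)"
      using f(4) f(1,2) by (auto intro!: derivative_eq_intros simp: power2_eq_square)
  qed (use f in auto)
qed

lemma jet2_ln:
  assumes "jet2 f a b c" "0 < a"
  shows "jet2 (\<lambda>t. ln (f t)) (ln a) (b / a) (c / a - (b / a)\<^sup>2)"
proof -
  have "\<forall>\<^sub>F y in nhds a. (ln has_real_derivative inverse y) (at y)"
    using eventually_nhds_in_open[of "{0<..}" a] assms(2)
    by (auto elim!: eventually_mono intro!: DERIV_ln)
  moreover have "(inverse has_real_derivative - (inverse a)\<^sup>2) (at a)"
    using assms(2) DERIV_inverse[of a] by (simp add: power2_eq_square)
  ultimately show ?thesis
    by (rule jet2_eq[OF jet2_compose[OF assms(1)]])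
      (use assms(2) in \<open>auto simp: field_simps power2_eq_square\<close>)
qed

lemma jet2_inverse:
  assumes "jet2 f a b c" "a \<noteq> 0"
  shows "jet2 (\<lambda>t. inverse (f t)) (inverse a) (- b / a\<^sup>2) (2 * b\<^sup>2 / a ^ 3 - c / a\<^sup>2)"
proof -
  have "\<forall>\<^sub>F y in nhds a. (inverse has_real_derivative - (inverse y)\<^sup>2) (at y)"
    using t1_space_nhds[OF assms(2)]
    by eventually_elim (metis DERIV_inverse numeral_2_eq_2)
  moreover have "((\<lambda>y. - (inverse y)\<^sup>2) has_real_derivative 2 / a ^ 3) (at a)"
    using assms(2)
    by (auto intro!: derivative_eq_intros simp: power2_eq_square power3_eq_cube divide_simps)
  ultimately show ?thesis
    by (rule jet2_eq[OF jet2_compose[OF assms(1)]])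
      (use assms(2) in \<open>auto simp: field_simps power2_eq_square\<close>)
qed

lemma jet2_arctan:
  assumes "jet2 f 0 b c"
  shows "jet2 (\<lambda>t. arctan (f t)) 0 b c"
proof -
  have "\<forall>\<^sub>F y in nhds 0. (arctan has_real_derivative inverse (1 + y\<^sup>2)) (at y)"
    by (auto intro!: always_eventually DERIV_arctan)
  moreover have "((\<lambda>y. inverse (1 + y\<^sup>2)) has_real_derivative 0) (at (0::real))"
    by (auto intro!: derivative_eq_intros)
  ultimately show ?thesis
    by (rule jet2_eq[OF jet2_compose[OF assms(1)]]) auto
qed

lemma jet2_sin:
  assumes "jet2 f 0 b c"
  shows "jet2 (\<lambda>t. sin (f t)) 0 b c"
proof -
  have "\<forall>\<^sub>F y in nhds (0::real). (sin has_real_derivative cos y) (at y)"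
    by (auto intro!: always_eventually DERIV_sin)
  moreover have "(cos has_real_derivative 0) (at (0::real))"
    using DERIV_cos[of "0::real"] by simp
  ultimately show ?thesis
    by (rule jet2_eq[OF jet2_compose[OF assms(1)]]) auto
qed

lemma jet2_cos:
  assumes "jet2 f 0 b c"
  shows "jet2 (\<lambda>t. cos (f t)) 1 0 (- b\<^sup>2)"
proof -
  have "\<forall>\<^sub>F y in nhds (0::real). (cos has_real_derivative - sin y) (at y)"
    by (auto intro!: always_eventually DERIV_cos)
  moreover have "((\<lambda>y. - sin y) has_real_derivative - 1) (at (0::real))"
    by (auto intro!: derivative_eq_intros)
  ultimately show ?thesis
    by (rule jet2_eq[OF jet2_compose[OF assms(1)]]) auto
qed

text \<open>For the second claim: as \<open>f'\<close> vanishes at 0, a positive \<open>c\<close>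
  would make \<open>f'\<close> positive just to the right of 0, and the mean value theorem would
  give a larger value of \<open>f\<close> there.\<close>

lemma jet2_local_max:
  assumes "jet2 f a b c" "\<forall>\<^sub>F t in nhds 0. f t \<le> f 0"
  shows "b = 0" "c \<le> 0"
proof -
  obtain f' where f: "f' 0 = b" "\<forall>\<^sub>F t in nhds 0. (f has_real_derivative f' t) (at t)"
      "(f' has_real_derivative c) (at 0)"
    using assms(1) unfolding jet2_def by blast
  have "\<forall>\<^sub>F t in nhds 0. (f has_real_derivative f' t) (at t) \<and> f t \<le> f 0"
    using f(2) assms(2) by eventually_elim auto
  then obtain d where d: "0 < d" "\<And>t. \<bar>t\<bar> < d \<Longrightarrow> (f has_real_derivative f' t) (at t)"
    "\<And>t. \<bar>t\<bar> < d \<Longrightarrow> f t \<le> f 0"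
    unfolding eventually_nhds_metric by (auto simp: dist_real_def)
  show b: "b = 0"
    using DERIV_local_max[OF d(2)[of 0] d(1)] d(1,3) f(1) by auto
  show "c \<le> 0"
  proof (rule ccontr)
    assume "\<not> c \<le> 0"
    then obtain e where e: "0 < e" "\<And>h. 0 < h \<Longrightarrow> h < e \<Longrightarrow> f' 0 < f' (0 + h)"
      using DERIV_pos_inc_right[OF f(3)] by auto
    define h where "h = min d e / 2"
    have h: "0 < h" "h < d" "h < e" using d(1) e(1) by (auto simp: h_def)
    have "\<exists>s. 0 < s \<and> s < h \<and> f h - f 0 = (h - 0) * f' s"
      by (rule MVT2[OF h(1)]) (use d(2) h in auto)
    then obtain s where s: "0 < s" "s < h" "f h - f 0 = h * f' s" by auto
    then have "0 < f h - f 0" using e(2)[of s] h b f(1) by simp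
    then show False using d(3)[of h] h by simp
  qed
qed

text \<open>Angle between the first axis and the top eigenvector of the symmetric matrix with rows
  \<open>(p, q)\<close> and \<open>(q, s)\<close>, valid when \<open>s < p\<close>.\<close>

definition eig_angle :: "(real \<Rightarrow> real) \<Rightarrow> (real \<Rightarrow> real) \<Rightarrow> (real \<Rightarrow> real) \<Rightarrow> real \<Rightarrow> real" where
  "eig_angle p q s t = arctan (2 * q t / (p t - s t)) / 2"

text \<open>As \<open>q\<close> vanishes at 0 and arctan has derivative 1 and second derivative 0
  there, the angle has the same 2-jet as \<open>q / (p - s)\<close>.\<close>

lemma jet2_eig_angle:
  assumes "jet2 p la p1 p2" "jet2 q 0 q1 q2" "jet2 s mu s1 s2" "mu < la"
  shows "jet2 (eig_angle p q s) 0 (q1 / (la - mu)) (q2 / (la - mu) - 2 * q1 * (p1 - s1) / (la - mu)\<^sup>2)"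
proof -
  define d where "d = la - mu"
  have d: "0 < d" using assms(4) by (simp add: d_def)
  have inv: "jet2 (\<lambda>t. inverse (p t - s t)) (inverse d) (- (p1 - s1) / d\<^sup>2)
      (2 * (p1 - s1)\<^sup>2 / d ^ 3 - (p2 - s2) / d\<^sup>2)"
    unfolding d_def using assms(4) by (intro jet2_inverse jet2_diff assms) auto
  have "jet2 (\<lambda>t. (2 * q t) * inverse (p t - s t)) 0 (2 * q1 / d)
    (2 * (q2 / d - 2 * q1 * (p1 - s1) / d\<^sup>2))"
    by (rule jet2_eq[OF jet2_mult[OF jet2_cmult[OF assms(2)] inv]])
      (use d in \<open>auto simp: field_simps power2_eq_square\<close>)
  then have "jet2 (\<lambda>t. 2 * q t / (p t - s t)) 0 (2 * q1 / d)
    (2 * (q2 / d - 2 * q1 * (p1 - s1) / d\<^sup>2))"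
    by (simp only: divide_inverse)
  from jet2_cmult[OF jet2_arctan[OF this], of "1/2"] show ?thesis
    unfolding eig_angle_def[abs_def] d_def[symmetric] by (simp add: diff_divide_distrib mult.assoc)
qed

text \<open>Second order perturbation theory: the function is the quadratic form on the unit vector
  at angle \<open>th\<close>. The rotation of the eigenvector is invisible at first order and
  contributes \<open>2 * q1^2 / (la - mu)\<close> at second order.\<close>

lemma jet2_eigenvalue:
  assumes "jet2 p la p1 p2" "jet2 q 0 q1 q2" "jet2 s mu s1 s2" "mu < la"
  defines "th \<equiv> eig_angle p q s"
  shows "jet2 (\<lambda>t. p t * (cos (th t))\<^sup>2 + 2 * q t * (sin (th t) * cos (th t)) + s t * (sin (th t))\<^sup>2)
    la p1 (p2 + 2 * q1\<^sup>2 / (la - mu))"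
proof -
  note th = jet2_eig_angle[OF assms(1-4), folded th_def]
  obtain d where d: "la = mu + d" "0 < d" using assms(4) by (metis add.commute diff_add_cancel diff_gt_0_iff_gt)
  show ?thesis
    by (rule jet2_eq[OF jet2_add[OF jet2_add[OF jet2_mult[OF assms(1) jet2_power2[OF jet2_cos[OF th]]]
        jet2_mult[OF jet2_cmult[OF assms(2), of 2] jet2_mult[OF jet2_sin[OF th] jet2_cos[OF th]]]]
        jet2_mult[OF assms(3) jet2_power2[OF jet2_sin[OF th]]]]])
      (use d in \<open>auto simp: field_simps power2_eq_square\<close>)
qed

lemma jet2_ln_cutoff:
  assumes "jet2 y x y1 y2" "\<bar>x\<bar> < 1"
  shows "jet2 (\<lambda>t. 2 * ln (1 - (y t)\<^sup>2)) (2 * ln (1 - x\<^sup>2)) ((- 4 * x / (1 - x\<^sup>2)) * y1)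
    ((- 4 * (1 + x\<^sup>2) / (1 - x\<^sup>2)\<^sup>2) * y1\<^sup>2 + (- 4 * x / (1 - x\<^sup>2)) * y2)"
proof -
  have pos: "0 < 1 - x\<^sup>2" using assms(2) by (simp add: abs_square_less_1)
  have split: "2 * ((0 - (2 * y1\<^sup>2 + 2 * x * y2)) / E - ((0 - 2 * x * y1) / E)\<^sup>2)
      = - 4 * (1 + x\<^sup>2) / E\<^sup>2 * y1\<^sup>2 + - 4 * x / E * y2" if "0 < E" "E = 1 - x\<^sup>2" for E
  proof -
    have "2 * ((0 - (2 * y1\<^sup>2 + 2 * x * y2)) / E - ((0 - 2 * x * y1) / E)\<^sup>2)
      = (- 4 * y1\<^sup>2 * E - 8 * x\<^sup>2 * y1\<^sup>2) / E\<^sup>2 - 4 * x * y2 / E"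
      using that(1) by (simp add: field_simps power2_eq_square)
    also have "- 4 * y1\<^sup>2 * E - 8 * x\<^sup>2 * y1\<^sup>2 = - 4 * (1 + x\<^sup>2) * y1\<^sup>2"
      unfolding that(2) by (simp add: algebra_simps)
    finally show ?thesis by simp
  qed
  show ?thesis
    by (rule jet2_eq[OF jet2_cmult[OF jet2_ln[OF jet2_diff[OF jet2_const jet2_power2[OF assms(1)]] pos]]])
      (use pos split[OF pos refl] in auto)
qed

text \<open>Coordinates of a moving point in a moving frame. The terms with \<open>T1\<close> and
  \<open>T2\<close> are the price for cutoffs tied to the eigendirections; those with
  \<open>T2\<close> are controlled later by \<open>linearised_operator_angle\<close>.\<close>

lemma jet2_rotated_coordinates:
  assumes "jet2 th 0 T1 T2"
  shows "jet2 (\<lambda>t. (x1 + k1 * t) * cos (th t) + (x2 + k2 * t) * sin (th t)) x1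
      (k1 + x2 * T1) (2 * k2 * T1 + x2 * T2 - x1 * T1\<^sup>2)"
    and "jet2 (\<lambda>t. (x2 + k2 * t) * cos (th t) - (x1 + k1 * t) * sin (th t)) x2
      (k2 - x1 * T1) (- 2 * k1 * T1 - x1 * T2 - x2 * T1\<^sup>2)"
proof -
  note cs = jet2_mult[OF jet2_affine jet2_cos[OF assms]] jet2_mult[OF jet2_affine jet2_sin[OF assms]]
  show "jet2 (\<lambda>t. (x1 + k1 * t) * cos (th t) + (x2 + k2 * t) * sin (th t)) x1
      (k1 + x2 * T1) (2 * k2 * T1 + x2 * T2 - x1 * T1\<^sup>2)"
    by (rule jet2_eq[OF jet2_add[OF cs]]) auto
  show "jet2 (\<lambda>t. (x2 + k2 * t) * cos (th t) - (x1 + k1 * t) * sin (th t)) x2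
      (k2 - x1 * T1) (- 2 * k1 * T1 - x1 * T2 - x2 * T1\<^sup>2)"
    by (rule jet2_eq[OF jet2_diff[OF cs]]) auto
qed

definition eig_val :: "(real \<Rightarrow> real) \<Rightarrow> (real \<Rightarrow> real) \<Rightarrow> (real \<Rightarrow> real) \<Rightarrow> real \<Rightarrow> real" where
  "eig_val p q s t = p t * (cos (eig_angle p q s t))\<^sup>2
     + 2 * q t * (sin (eig_angle p q s t) * cos (eig_angle p q s t)) + s t * (sin (eig_angle p q s t))\<^sup>2"

text \<open>Logarithm of the maximised quantity along a line, in the eigenframe at its base point:
  \<open>(x1, x2)\<close> are the coordinates of that point, \<open>(k1, k2)\<close> those of the
  direction, \<open>p\<close>, \<open>q\<close>, \<open>s\<close> the Hessian entries and
  \<open>v1\<close>, \<open>v2\<close> the gradient components in that fixed frame.\<close>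

definition test_fun where
  "test_fun c p q s v1 v2 x1 k1 x2 k2 t = ln (eig_val p q s t)
    + 2 * ln (1 - ((x1 + k1 * t) * cos (eig_angle p q s t) + (x2 + k2 * t) * sin (eig_angle p q s t))\<^sup>2)
    + 2 * ln (1 - ((x2 + k2 * t) * cos (eig_angle p q s t) - (x1 + k1 * t) * sin (eig_angle p q s t))\<^sup>2)
    + c / 2 * ((v1 t)\<^sup>2 + (v2 t)\<^sup>2)" for c x1 k1 x2 k2 t :: real

lemma jet2_test_fun:
  assumes "jet2 p la p1 p2" "jet2 q 0 q1 q2" "jet2 s mu s1 s2" "mu < la" "0 < la"
    and "jet2 v1 w1 w1' w1''" "jet2 v2 w2 w2' w2''" and "\<bar>x1\<bar> < 1" "\<bar>x2\<bar> < 1"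
    and D: "D = la - mu" and T: "T = q1 / D" and TT: "TT = q2 / D - 2 * q1 * (p1 - s1) / D\<^sup>2"
    and a: "a = - 4 * x1 / (1 - x1\<^sup>2)" and a2: "a2 = - 4 * (1 + x1\<^sup>2) / (1 - x1\<^sup>2)\<^sup>2"
    and b: "b = - 4 * x2 / (1 - x2\<^sup>2)" and b2: "b2 = - 4 * (1 + x2\<^sup>2) / (1 - x2\<^sup>2)\<^sup>2"
  shows "jet2 (test_fun c p q s v1 v2 x1 k1 x2 k2)
    (ln la + 2 * ln (1 - x1\<^sup>2) + 2 * ln (1 - x2\<^sup>2) + c / 2 * (w1\<^sup>2 + w2\<^sup>2))
    (p1 / la + a * (k1 + x2 * T) + b * (k2 - x1 * T) + c * (w1 * w1' + w2 * w2'))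
    ((p2 + 2 * q1\<^sup>2 / D) / la - (p1 / la)\<^sup>2
      + (a2 * (k1 + x2 * T)\<^sup>2 + a * (2 * k2 * T + x2 * TT - x1 * T\<^sup>2))
      + (b2 * (k2 - x1 * T)\<^sup>2 + b * (- 2 * k1 * T - x1 * TT - x2 * T\<^sup>2))
      + c * (w1'\<^sup>2 + w1 * w1'' + (w2'\<^sup>2 + w2 * w2'')))"
proof -
  note th = jet2_eig_angle[OF assms(1-4), folded D, folded T TT]
  note w = jet2_eigenvalue[OF assms(1-4), folded D, folded eig_val_def]
  note y = jet2_rotated_coordinates[OF th]
  note y1 = jet2_ln_cutoff[OF y(1) assms(8), folded a a2]
  note y2 = jet2_ln_cutoff[OF y(2) assms(9), folded b b2]
  note v = jet2_cmult[OF jet2_add[OF jet2_power2[OF assms(6)] jet2_power2[OF assms(7)]], of "c / 2"]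
  show ?thesis
    unfolding test_fun_def[abs_def]
    by (rule jet2_eq[OF jet2_add[OF jet2_add[OF jet2_add[OF jet2_ln[OF w assms(5)] y1] y2] v]])
      (simp_all add: algebra_simps)
qed

section \<open>The inequality at a critical point\<close>

lemma abs_mult_mono2:
  fixes x y :: real
  assumes "\<bar>x\<bar> \<le> a" "\<bar>y\<bar> \<le> b"
  shows "\<bar>x * y\<bar> \<le> a * b"
  unfolding abs_mult using assms by (intro mult_mono) auto

text \<open>The three relations form a cycle: \<open>E2\<close> bounds \<open>u112\<close> by
  \<open>u122\<close>, \<open>e1\<close> bounds \<open>u122\<close> by \<open>u111\<close>, and
  \<open>E1\<close> bounds \<open>u111\<close> by \<open>u112\<close>. Because \<open>la\<close> is
  large, going round once multiplies by a factor below 1, so the cycle closes and gives absolute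
  bounds.\<close>

lemma frame_bounds:
  fixes la mu D f f1 c1 c2 G z x1 x2 a b u111 u112 u122 :: real
  assumes G: "1 \<le> G" and z: "1 \<le> z" and la: "1000 * G\<^sup>2 * z\<^sup>2 \<le> la"
    and f: "la * mu = f" "0 < f" "f \<le> G" "\<bar>f1\<bar> \<le> G"
    and c: "\<bar>c1\<bar> \<le> G" "\<bar>c2\<bar> \<le> G"
    and x: "\<bar>x1\<bar> \<le> 1" "\<bar>x2\<bar> \<le> 1" and ab: "\<bar>a\<bar> \<le> 4 * z" "\<bar>b\<bar> \<le> 4 * z"
    and D: "D = la - mu"
    and e1: "f1 = mu * u111 + la * u122"
    and E1: "u111 / la + a * (1 + x2 * (u112 / D)) + b * (- x1 * (u112 / D)) + c1 * la = 0"
    and E2: "u112 / la + a * (x2 * (u122 / D)) + b * (1 - x1 * (u122 / D)) + c2 * mu = 0"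
  shows "la / 2 \<le> D" "D \<le> la" "0 < mu" "mu * z\<^sup>2 \<le> 1 / 1000"
    "\<bar>u112 / D\<bar> \<le> 10 * z" "\<bar>la * (u122 / D)\<bar> \<le> 4 * G\<^sup>2"
    "\<bar>u112 / la\<bar> \<le> 5 * z" "\<bar>u111 / la\<bar> \<le> 2 * G * la"
proof -
  \<comment> \<open>Products of \<open>G\<close> and \<open>z\<close> with exponents at most 2 are
    bounded by \<open>Q\<close>, and \<open>la\<close> exceeds \<open>Q\<close> by a factor 1000;
    the comparisons below reduce to these two facts.\<close>
  define Q where "Q = G\<^sup>2 * z\<^sup>2"
  have Q: "1 \<le> G\<^sup>2" "1 \<le> z\<^sup>2" "G \<le> G\<^sup>2" "z \<le> z\<^sup>2"
    using G z by (auto simp: one_le_power self_le_power)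
  have le: "x * y \<le> Q" if "0 \<le> x" "x \<le> G\<^sup>2" "0 \<le> y" "y \<le> z\<^sup>2" for x y
    unfolding Q_def using that by (intro mult_mono) auto
  have q: "1 \<le> Q" "G \<le> Q" "z \<le> Q" "G * z \<le> Q" "G\<^sup>2 \<le> Q" "z\<^sup>2 \<le> Q" "G * z\<^sup>2 \<le> Q" "G\<^sup>2 * z \<le> Q"
    using le[of 1 1] le[of G 1] le[of 1 z] le[of G z] le[of "G\<^sup>2" 1] le[of 1 "z\<^sup>2"] le[of G "z\<^sup>2"]
      le[of "G\<^sup>2" z] G z Q by auto
  have laQ: "1000 * Q \<le> la" using la by (simp add: Q_def)
  have la0: "1000 \<le> la" using laQ q by linarith
  have mu: "mu = f / la" using f(1) la0 by (auto simp: field_simps)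
  show mu0: "0 < mu" using mu f(2) la0 by auto
  have muG: "mu \<le> G / la" unfolding mu using f(3) la0 by (intro divide_right_mono) auto
  also have "\<dots> \<le> 1" using laQ q la0 by (simp add: field_simps)
  finally have mu1: "mu \<le> 1" .
  show D1: "la / 2 \<le> D" and D2: "D \<le> la" using D mu0 mu1 la0 by auto
  have D0: "0 < D" using D1 la0 by linarith
  have "mu * z\<^sup>2 \<le> (G / la) * z\<^sup>2" using muG by (intro mult_right_mono) auto
  also have "\<dots> \<le> 1 / 1000" using laQ q(7) la0 by (simp add: field_simps)
  finally show "mu * z\<^sup>2 \<le> 1 / 1000" .
  define A B t1 Y k where "A = u111 / la" and "B = u112 / la" and "t1 = \<bar>u112 / D\<bar>"
    and "Y = \<bar>la * (u122 / D)\<bar>" and "k = a * x2 - b * x1"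
  have nn: "0 \<le> t1" "0 \<le> Y" by (auto simp: t1_def Y_def)
  have "\<bar>a * x2\<bar> \<le> 4 * z * 1" "\<bar>b * x1\<bar> \<le> 4 * z * 1" using ab x by (intro abs_mult_mono2; simp)+
  then have k: "\<bar>k\<bar> \<le> 8 * z" unfolding k_def by linarith
  have la_D: "\<bar>la / D\<bar> \<le> 2" using D1 D0 la0 by (simp add: field_simps)
  have T2: "\<bar>u122 / D\<bar> = Y / la" using la0 by (simp add: Y_def abs_mult)
  have A_eq: "A = - (a + k * (u112 / D) + c1 * la)" using E1 by (simp add: A_def k_def algebra_simps)
  have B_eq: "B = - (b + k * (u122 / D) + c2 * mu)" using E2 by (simp add: B_def k_def algebra_simps)
  have kT1: "\<bar>k * (u112 / D)\<bar> \<le> 8 * z * t1" by (rule abs_mult_mono2[OF k]) (simp add: t1_def)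
  have kT2: "\<bar>k * (u122 / D)\<bar> \<le> 8 * z * (Y / la)" by (rule abs_mult_mono2[OF k eq_refl[OF T2]])
  have c1: "\<bar>c1 * la\<bar> \<le> G * la" by (rule abs_mult_mono2[OF c(1)]) (use la0 in simp)
  have c2: "\<bar>c2 * mu\<bar> \<le> G * (G / la)" by (rule abs_mult_mono2[OF c(2)]) (use muG mu0 in simp)
  have G2la: "G * (G / la) \<le> 1 / 1000" using q(5) laQ la0 by (simp add: field_simps power2_eq_square)
  have Babs: "\<bar>B\<bar> \<le> 4 * z + 8 * z * (Y / la) + 1 / 1000"
    using B_eq kT2 c2 ab(2) G2la by linarith
  have Aabs: "\<bar>A\<bar> \<le> 4 * z + 8 * z * t1 + G * la"
    using A_eq kT1 c1 ab(1) by linarith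
  have T1: "u112 / D = (la / D) * B" using la0 D0 by (simp add: B_def)
  have t1B: "t1 \<le> 2 * \<bar>B\<bar>"
    unfolding t1_def T1 by (rule abs_mult_mono2[OF la_D order_refl])
  have "la * u122 = f1 - f * A"
    using e1 f(1) la0 by (simp add: A_def field_simps)
  then have "la * (u122 / D) = (f1 - f * A) / D" by simp
  then have "Y = \<bar>f1 - f * A\<bar> / D" using D0 by (simp add: Y_def)
  also have "\<dots> \<le> (G + G * \<bar>A\<bar>) / (la / 2)"
  proof (rule frac_le)
    have "\<bar>f * A\<bar> \<le> G * \<bar>A\<bar>" by (rule abs_mult_mono2) (use f in auto)
    then show "\<bar>f1 - f * A\<bar> \<le> G + G * \<bar>A\<bar>" using f(4) by linarith
    show "0 \<le> G + G * \<bar>A\<bar>" using G by simp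
  qed (use D1 la0 in auto)
  finally have YA: "la * Y \<le> 2 * G + 2 * G * \<bar>A\<bar>" using la0 by (simp add: field_simps)
  have zY: "z * (Y / la) \<le> Y / 1000"
  proof -
    have "z * Y \<le> (la / 1000) * Y" using q(3) laQ nn by (intro mult_right_mono) auto
    then show ?thesis using la0 by (simp add: field_simps)
  qed
  have t1_le: "t1 \<le> 9 * z + Y / 60" using t1B Babs zY z nn by linarith
  have "2 * G * \<bar>A\<bar> \<le> 2 * G * (4 * z + 8 * z * (9 * z + Y / 60) + G * la)"
    by (rule mult_left_mono[OF order_trans[OF Aabs]]) (use G z t1_le in \<open>auto intro!: mult_left_mono\<close>)
  also have "\<dots> = 8 * (G * z) + 144 * (G * z\<^sup>2) + (16 / 60) * (G * z) * Y + 2 * G\<^sup>2 * la"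
    by (simp add: algebra_simps power2_eq_square)
  also have "\<dots> \<le> 8 * (la / 1000) + 144 * (la / 1000) + (16 / 60) * (la / 1000) * Y + 2 * G\<^sup>2 * la"
    using q laQ nn by (intro add_mono mult_left_mono mult_right_mono) auto
  \<comment> \<open>The coefficient of \<open>Y\<close> inside the bracket is below 1, so
    \<open>Y\<close> can be absorbed on the left: this closes the cycle.\<close>
  finally have "la * Y \<le> la * (1 / 5 + Y / 1000 + 2 * G\<^sup>2)"
    using YA q(2) laQ mult_nonneg_nonneg[OF nn(2), of la] la0 by (simp add: algebra_simps)
  then have "Y \<le> 1 / 5 + Y / 1000 + 2 * G\<^sup>2" using la0 by simp
  then show Y: "\<bar>la * (u122 / D)\<bar> \<le> 4 * G\<^sup>2" using Q unfolding Y_def[symmetric] by linarith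
  have "z * (Y / la) \<le> z * (4 * G\<^sup>2 / la)"
    using Y z la0 unfolding Y_def[symmetric] by (intro mult_left_mono divide_right_mono) auto
  also have "\<dots> \<le> 4 / 1000" using q(8) laQ la0 by (simp add: field_simps)
  finally have zY': "z * (Y / la) \<le> 4 / 1000" .
  show B: "\<bar>u112 / la\<bar> \<le> 5 * z" using Babs zY' z unfolding B_def by linarith
  then show t1: "\<bar>u112 / D\<bar> \<le> 10 * z" using t1B unfolding t1_def B_def by linarith
  have "8 * z * t1 \<le> 8 * z * (10 * z)" using t1 z unfolding t1_def by (intro mult_left_mono) auto
  then have "8 * z * t1 \<le> 80 * z\<^sup>2" by (simp add: power2_eq_square)
  then have "\<bar>A\<bar> \<le> 84 * z\<^sup>2 + G * la" using Aabs Q by linarith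
  also have "84 * z\<^sup>2 \<le> 1 * la" using q laQ by linarith
  also have "\<dots> \<le> G * la" using G la0 by (intro mult_right_mono) auto
  finally show "\<bar>u111 / la\<bar> \<le> 2 * G * la" unfolding A_def by linarith
qed

text \<open>The left-hand side is the linearised operator \<open>mu d\<^sub>1\<^sub>1 + la d\<^sub>2\<^sub>2\<close> applied to the eigenvector angle.
  All products of third derivatives cancel; for constant \<open>f\<close> the angle is annihilated.\<close>

lemma linearised_operator_angle:
  fixes la mu D f1 f2 f12 u111 u112 u122 u222 u1112 u1222 :: real
  assumes "D \<noteq> 0" "la \<noteq> 0"
    and e1: "f1 = mu * u111 + la * u122" and e2: "f2 = mu * u112 + la * u222"
    and e12: "f12 = mu * u1112 + u111 * u222 + la * u1222 - u112 * u122"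
  shows "mu * (u1112 / D - 2 * u112 * (u111 - u122) / D\<^sup>2)
      + la * (u1222 / D - 2 * u122 * (u112 - u222) / D\<^sup>2)
    = (f12 - f2 * (u111 / la) + f1 * (u112 / la)) / D - 2 * (f1 * u112 - f2 * u122) / D\<^sup>2"
proof -
  have eq1: "f12 - f2 * (u111 / la) + f1 * (u112 / la) = mu * u1112 + la * u1222"
    using assms(2) unfolding e1 e2 e12 by (simp add: field_simps)
  have eq2: "f1 * u112 - f2 * u122 = mu * u112 * (u111 - u122) + la * u122 * (u112 - u222)"
    unfolding e1 e2 by (simp add: algebra_simps)
  show ?thesis
    unfolding eq1 eq2 by (simp add: add_divide_distrib diff_divide_distrib algebra_simps)
qed

text \<open>\<open>E1\<close>, \<open>E2\<close>, \<open>I1\<close>, \<open>I2\<close> are the first and second order conditions at a maximum of the test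
  function in coordinates diagonalising the Hessian; \<open>a\<close>, \<open>a2\<close>, \<open>b\<close>, \<open>b2\<close> are the derivatives of the
  logarithmic cutoffs and \<open>1 / z\<close> is the product of the cutoffs. In \<open>mu I1 + la I2\<close> everything except
  \<open>la (b\<^sup>2 + b2 + c f)\<close> is of order \<open>G\<^sup>2 z\<^sup>2\<close>.\<close>

lemma no_critical_jet:
  fixes la mu D f f1 f2 f11 f12 c v1 v2 G z x1 x2 a b a2 b2 u111 u112 u122 u222
    u1111 u1112 u1122 u1222 :: real
  assumes G: "1 \<le> G" and z: "1 \<le> z" and la: "1000 * G\<^sup>2 * z\<^sup>2 \<le> la"
    and f: "la * mu = f" "0 < f" "f \<le> G"
    and fd: "\<bar>f1\<bar> \<le> G" "\<bar>f2\<bar> \<le> G" "\<bar>f11\<bar> \<le> G" "\<bar>f12\<bar> \<le> G"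
    and c: "\<bar>c * v1\<bar> \<le> G" "\<bar>c * v2\<bar> \<le> G" "5 \<le> c * f" "0 \<le> c"
    and x: "\<bar>x1\<bar> \<le> 1" "\<bar>x2\<bar> \<le> 1" and ab: "\<bar>a\<bar> \<le> 4 * z" "\<bar>b\<bar> \<le> 4 * z"
    and ab2: "\<bar>a2\<bar> \<le> 8 * z\<^sup>2" "\<bar>b2\<bar> \<le> 8 * z\<^sup>2" "- 4 \<le> b\<^sup>2 + b2" "a * x1 \<le> 0" "b * x2 \<le> 0"
    and D: "D = la - mu"
    and e1: "f1 = mu * u111 + la * u122" and e2: "f2 = mu * u112 + la * u222"
    and e11: "f11 = mu * u1111 + 2 * u111 * u122 + la * u1122 - 2 * u112\<^sup>2"
    and e12: "f12 = mu * u1112 + u111 * u222 + la * u1222 - u112 * u122"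
    and E1: "u111 / la + a * (1 + x2 * (u112 / D)) + b * (- x1 * (u112 / D)) + c * (v1 * la) = 0"
    and E2: "u112 / la + a * (x2 * (u122 / D)) + b * (1 - x1 * (u122 / D)) + c * (v2 * mu) = 0"
    and T11: "T11 = u1112 / D - 2 * u112 * (u111 - u122) / D\<^sup>2"
    and T22: "T22 = u1222 / D - 2 * u122 * (u112 - u222) / D\<^sup>2"
    and I1: "(u1111 + 2 * u112\<^sup>2 / D) / la - (u111 / la)\<^sup>2
      + (a2 * (1 + x2 * (u112 / D))\<^sup>2 + a * (x2 * T11 - x1 * (u112 / D)\<^sup>2))
      + (b2 * (- x1 * (u112 / D))\<^sup>2 + b * (- 2 * (u112 / D) - x1 * T11 - x2 * (u112 / D)\<^sup>2))
      + c * (la\<^sup>2 + v1 * u111 + v2 * u112) \<le> 0" (is "?I1 \<le> 0")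
    and I2: "(u1122 + 2 * u122\<^sup>2 / D) / la - (u112 / la)\<^sup>2
      + (a2 * (x2 * (u122 / D))\<^sup>2 + a * (2 * (u122 / D) + x2 * T22 - x1 * (u122 / D)\<^sup>2))
      + (b2 * (1 - x1 * (u122 / D))\<^sup>2 + b * (- x1 * T22 - x2 * (u122 / D)\<^sup>2))
      + c * (mu\<^sup>2 + v1 * u122 + v2 * u222) \<le> 0" (is "?I2 \<le> 0")
  shows False
proof -
  define A B T1 T2 Y k LT where "A = u111 / la" and "B = u112 / la" and "T1 = u112 / D"
    and "T2 = u122 / D" and "Y = la * T2" and "k = a * x2 - b * x1" and "LT = mu * T11 + la * T22"
  note bounds = frame_bounds[OF G z la f(1,2,3) fd(1) c(1,2) x ab D e1]
  have E: "u111 / la + a * (1 + x2 * (u112 / D)) + b * (- x1 * (u112 / D)) + c * v1 * la = 0"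
    "u112 / la + a * (x2 * (u122 / D)) + b * (1 - x1 * (u122 / D)) + c * v2 * mu = 0"
    using E1 E2 by (simp_all add: mult.assoc)
  note bd = bounds[OF E, folded A_def B_def T1_def T2_def Y_def]
  have sq: "1 \<le> G\<^sup>2" "1 \<le> z\<^sup>2" "G \<le> G\<^sup>2" "z \<le> z\<^sup>2"
    using G z by (auto simp: one_le_power self_le_power)
  define Q where "Q = G\<^sup>2 * z\<^sup>2"
  have le: "x * y \<le> Q" if "0 \<le> x" "x \<le> G\<^sup>2" "0 \<le> y" "y \<le> z\<^sup>2" for x y
    unfolding Q_def using that by (intro mult_mono) auto
  have q: "1 \<le> Q" "G \<le> Q" "z \<le> Q" "G * z \<le> Q" "G\<^sup>2 \<le> Q" "z\<^sup>2 \<le> Q" "G * z\<^sup>2 \<le> Q" "G\<^sup>2 * z \<le> Q"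
    using le[of 1 1] le[of G 1] le[of 1 z] le[of G z] le[of "G\<^sup>2" 1] le[of 1 "z\<^sup>2"] le[of G "z\<^sup>2"]
      le[of "G\<^sup>2" z] G z sq by auto
  have laQ: "1000 * Q \<le> la" using la by (simp add: Q_def)
  have la0: "1000 \<le> la" using laQ q by linarith
  have D0: "0 < D" using bd(1) la0 by linarith
  have k: "\<bar>k\<bar> \<le> 8 * z"
  proof -
    have "\<bar>a * x2\<bar> \<le> 4 * z * 1" "\<bar>b * x1\<bar> \<le> 4 * z * 1" using ab x by (intro abs_mult_mono2; simp)+
    then show ?thesis unfolding k_def by linarith
  qed
  have T2: "T2 = Y / la" using la0 by (simp add: Y_def)
  have T2z: "z\<^sup>2 * \<bar>T2\<bar> \<le> 4 / 1000"
  proof -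
    have "z\<^sup>2 * \<bar>T2\<bar> \<le> z\<^sup>2 * (4 * G\<^sup>2 / la)"
      using bd(6) la0 unfolding T2 by (auto intro!: mult_left_mono divide_right_mono)
    also have "\<dots> \<le> 4 / 1000" using laQ la0 unfolding Q_def by (simp add: field_simps)
    finally show ?thesis .
  qed
  have x1s: "x1\<^sup>2 \<le> 1" "x2\<^sup>2 \<le> 1" using x by (auto simp: abs_square_le_1)
  have laT2: "0 \<le> la * T2\<^sup>2" "z\<^sup>2 * (la * T2\<^sup>2) \<le> (16 / 1000) * G\<^sup>2"
  proof -
    show "0 \<le> la * T2\<^sup>2" using la0 by simp
    have "z\<^sup>2 * (la * T2\<^sup>2) = (z\<^sup>2 * \<bar>T2\<bar>) * \<bar>Y\<bar>"
      using la0 by (simp add: Y_def abs_mult power2_eq_square)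
    also have "\<dots> \<le> (4 / 1000) * (4 * G\<^sup>2)"
      by (rule mult_mono[OF T2z bd(6)]) auto
    finally show "z\<^sup>2 * (la * T2\<^sup>2) \<le> (16 / 1000) * G\<^sup>2" by simp
  qed
  \<comment> \<open>\<open>e11\<close> eliminates the fourth derivatives, leaving
    \<open>2 * la * B^2 - 2 * A * u122\<close>, and by \<open>e1\<close> the second term is
    \<open>2 * mu * A^2\<close> up to a multiple of \<open>f1\<close>. Together they outweigh the
    negative squares from the logarithm: \<open>mu * A^2 + la * B^2\<close> survives with the good
    sign.\<close>
  have sum: "mu * ?I1 + la * ?I2 =
      f11 / la - 2 * f1 * (A / la) + mu * A\<^sup>2 + la * B\<^sup>2 + 2 * (mu * u112\<^sup>2 + la * u122\<^sup>2) / (D * la)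
      + a2 * (mu * (1 + x2 * T1)\<^sup>2) + a2 * (x2\<^sup>2 * (la * T2\<^sup>2))
      + b2 * (mu * (x1\<^sup>2 * T1\<^sup>2)) + b2 * (la * (1 - x1 * T2)\<^sup>2)
      + 2 * (a * Y) - 2 * (b * (mu * T1)) + k * LT + (- (a * x1) - b * x2) * (mu * T1\<^sup>2 + la * T2\<^sup>2)
      + c * f * la + c * f * mu + c * v1 * f1 + c * v2 * f2"
  proof -
    have "mu * u1111 + la * u1122 = f11 - 2 * u111 * u122 + 2 * u112\<^sup>2" using e11 by simp
    then have "(mu * u1111 + la * u1122) / la = f11 / la - 2 * A * u122 + 2 * la * B\<^sup>2"
      using la0 by (simp add: A_def B_def add_divide_distrib diff_divide_distrib power2_eq_square)
    moreover have "- 2 * A * u122 = - 2 * f1 * (A / la) + 2 * mu * A\<^sup>2"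
      using la0 by (simp add: A_def e1 field_simps power2_eq_square)
    moreover have "c * (mu * la\<^sup>2 + la * mu\<^sup>2 + v1 * (mu * u111 + la * u122) + v2 * (mu * u112 + la * u222))
      = c * f * la + c * f * mu + c * v1 * f1 + c * v2 * f2"
      unfolding f(1)[symmetric] e1 e2 by (simp add: algebra_simps power2_eq_square)
    moreover have "mu * ?I1 + la * ?I2 = (mu * u1111 + la * u1122) / la - mu * A\<^sup>2 - la * B\<^sup>2
      + 2 * (mu * u112\<^sup>2 + la * u122\<^sup>2) / (D * la)
      + a2 * (mu * (1 + x2 * T1)\<^sup>2) + a2 * (x2\<^sup>2 * (la * T2\<^sup>2))
      + b2 * (mu * (x1\<^sup>2 * T1\<^sup>2)) + b2 * (la * (1 - x1 * T2)\<^sup>2)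
      + 2 * (a * Y) - 2 * (b * (mu * T1)) + k * LT + (- (a * x1) - b * x2) * (mu * T1\<^sup>2 + la * T2\<^sup>2)
      + c * (mu * la\<^sup>2 + la * mu\<^sup>2 + v1 * (mu * u111 + la * u122) + v2 * (mu * u112 + la * u222))"
      unfolding A_def[symmetric] B_def[symmetric] T1_def[symmetric] T2_def[symmetric] Y_def k_def LT_def
      by (simp add: power_mult_distrib add_divide_distrib algebra_simps)
    ultimately show ?thesis by linarith
  qed
  have t1: "- G \<le> f11 / la"
  proof -
    have "\<bar>f11 / la\<bar> \<le> G / 1" unfolding abs_divide using fd(3) la0 G by (intro frac_le) auto
    then show ?thesis by linarith
  qed
  have t2: "- 4 * G\<^sup>2 \<le> - 2 * f1 * (A / la)"
  proof -
    have "\<bar>A / la\<bar> \<le> 2 * G" using bd(8) la0 by (simp add: field_simps)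
    then have "\<bar>f1 * (A / la)\<bar> \<le> G * (2 * G)" by (rule abs_mult_mono2[OF fd(1)])
    then have "f1 * (A / la) \<le> G * (2 * G)" by (rule abs_le_D1)
    then show ?thesis by (simp add: power2_eq_square)
  qed
  \<comment> \<open>The first order condition says \<open>B = -b\<close> up to small terms, so the
    good third order term supplies \<open>la * b^2\<close>. The loss is twice the cross term
    \<open>b * e\<close>, with \<open>132 = 4 * (32 + 1)\<close>.\<close>
  have t3: "la * b\<^sup>2 - 264 * Q \<le> la * B\<^sup>2"
  proof -
    define e where "e = k * Y + c * v2 * f"
    have B: "B = - (b + k * T2 + c * v2 * mu)"
      using E(2) unfolding B_def k_def T2_def by (simp add: algebra_simps)
    have "la * B\<^sup>2 = la * b\<^sup>2 + 2 * (b * e) + la * (k * T2 + c * v2 * mu)\<^sup>2"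
      unfolding B e_def Y_def f(1)[symmetric] by (simp add: power2_eq_square algebra_simps)
    moreover have "0 \<le> la * (k * T2 + c * v2 * mu)\<^sup>2" using la0 by simp
    moreover have "\<bar>b * e\<bar> \<le> 132 * Q"
    proof -
      have "\<bar>k * Y\<bar> \<le> 8 * z * (4 * G\<^sup>2)" by (rule abs_mult_mono2[OF k bd(6)])
      moreover have "\<bar>c * v2 * f\<bar> \<le> G * G" by (rule abs_mult_mono2[OF c(2)]) (use f in auto)
      moreover have "G * G \<le> z * G\<^sup>2" using mult_right_mono[OF z, of "G * G"] by (simp add: power2_eq_square)
      ultimately have "\<bar>e\<bar> \<le> 33 * (z * G\<^sup>2)" unfolding e_def by linarith
      then have "\<bar>b * e\<bar> \<le> 4 * z * (33 * (z * G\<^sup>2))" by (rule abs_mult_mono2[OF ab(2)])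
      then show ?thesis by (simp add: Q_def power2_eq_square algebra_simps)
    qed
    ultimately show ?thesis by linarith
  qed
  have T1s: "T1\<^sup>2 \<le> 100 * z\<^sup>2" using power_mono[OF bd(5), of 2] by (simp add: power_mult_distrib)
  \<comment> \<open>Cutoff terms belonging to the first direction carry the factor
    \<open>mu\<close>, and \<open>mu * z^2\<close> is at most \<open>1 / 1000\<close>; the same
    mechanism gives \<open>t6\<close> and \<open>t9\<close>.\<close>
  have t4: "- z\<^sup>2 \<le> a2 * (mu * (1 + x2 * T1)\<^sup>2)"
  proof -
    have "\<bar>x2 * T1\<bar> \<le> 1 * (10 * z)" by (rule abs_mult_mono2[OF x(2) bd(5)])
    then have "\<bar>1 + x2 * T1\<bar> \<le> 11 * z" using z by linarith
    then have "(1 + x2 * T1)\<^sup>2 \<le> 121 * z\<^sup>2"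
      using power_mono[of "\<bar>1 + x2 * T1\<bar>" "11 * z" 2] by (simp add: power_mult_distrib)
    then have "mu * (1 + x2 * T1)\<^sup>2 \<le> mu * (121 * z\<^sup>2)" using bd(3) by (intro mult_left_mono) auto
    moreover have "0 \<le> mu * (1 + x2 * T1)\<^sup>2" using bd(3) by simp
    ultimately have "\<bar>mu * (1 + x2 * T1)\<^sup>2\<bar> \<le> 121 / 1000" using bd(4) by linarith
    then have "\<bar>a2 * (mu * (1 + x2 * T1)\<^sup>2)\<bar> \<le> 8 * z\<^sup>2 * (121 / 1000)" by (rule abs_mult_mono2[OF ab2(1)])
    then show ?thesis using sq by linarith
  qed
  have t5: "- G\<^sup>2 \<le> a2 * (x2\<^sup>2 * (la * T2\<^sup>2))"
  proof -
    have "x2\<^sup>2 * (la * T2\<^sup>2) \<le> 1 * (la * T2\<^sup>2)" using x1s laT2 by (intro mult_right_mono) auto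
    then have "\<bar>a2 * (x2\<^sup>2 * (la * T2\<^sup>2))\<bar> \<le> 8 * z\<^sup>2 * (la * T2\<^sup>2)"
      using laT2(1) la0 by (intro abs_mult_mono2[OF ab2(1)]) (auto simp: abs_mult)
    then show ?thesis using laT2(2) sq by linarith
  qed
  have t6: "- z\<^sup>2 \<le> b2 * (mu * (x1\<^sup>2 * T1\<^sup>2))"
  proof -
    have "x1\<^sup>2 * T1\<^sup>2 \<le> 1 * (100 * z\<^sup>2)" using x1s T1s by (intro mult_mono) auto
    then have "mu * (x1\<^sup>2 * T1\<^sup>2) \<le> mu * (100 * z\<^sup>2)" using bd(3) by (intro mult_left_mono) auto
    moreover have "0 \<le> mu * (x1\<^sup>2 * T1\<^sup>2)" using bd(3) by simp
    ultimately have "\<bar>mu * (x1\<^sup>2 * T1\<^sup>2)\<bar> \<le> 100 / 1000" using bd(4) by linarith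
    then have "\<bar>b2 * (mu * (x1\<^sup>2 * T1\<^sup>2))\<bar> \<le> 8 * z\<^sup>2 * (100 / 1000)" by (rule abs_mult_mono2[OF ab2(2)])
    then show ?thesis using sq by linarith
  qed
  \<comment> \<open>Isolates \<open>la * b2\<close>, which alone may be as negative as
    \<open>la * z^2\<close> and has to be paired with \<open>la * b^2\<close> from
    \<open>t3\<close>. The loss is \<open>65 = 2 * 32 + 1\<close>.\<close>
  have t7: "la * b2 - 65 * Q \<le> b2 * (la * (1 - x1 * T2)\<^sup>2)"
  proof -
    have "b2 * (la * (1 - x1 * T2)\<^sup>2) = la * b2 - 2 * (b2 * (x1 * Y)) + b2 * (x1\<^sup>2 * (la * T2\<^sup>2))"
      unfolding Y_def by (simp add: power2_eq_square algebra_simps)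
    moreover have "\<bar>b2 * (x1 * Y)\<bar> \<le> 8 * z\<^sup>2 * (1 * (4 * G\<^sup>2))"
      by (intro abs_mult_mono2 ab2 x bd)
    moreover have "\<bar>b2 * (x1\<^sup>2 * (la * T2\<^sup>2))\<bar> \<le> G\<^sup>2"
    proof -
      have "x1\<^sup>2 * (la * T2\<^sup>2) \<le> 1 * (la * T2\<^sup>2)" using x1s laT2 by (intro mult_right_mono) auto
      then have "\<bar>b2 * (x1\<^sup>2 * (la * T2\<^sup>2))\<bar> \<le> 8 * z\<^sup>2 * (la * T2\<^sup>2)"
        using laT2(1) la0 by (intro abs_mult_mono2[OF ab2(2)]) (auto simp: abs_mult)
      then show ?thesis using laT2(2) sq by linarith
    qed
    ultimately show ?thesis using q(5) unfolding Q_def by (simp add: algebra_simps)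
  qed
  have t8: "- 16 * Q \<le> a * Y"
    using abs_mult_mono2[OF ab(1) bd(6)] q(8) by (simp add: algebra_simps)
  have t9: "b * (mu * T1) \<le> z\<^sup>2"
  proof -
    have "mu * \<bar>T1\<bar> \<le> mu * (10 * z\<^sup>2)" using bd(3,5) sq by (intro mult_left_mono) auto
    moreover have "\<bar>mu * T1\<bar> = mu * \<bar>T1\<bar>" using bd(3) by (simp add: abs_mult)
    ultimately have "\<bar>mu * T1\<bar> \<le> 10 / 1000" using bd(4) by linarith
    then have "\<bar>b * (mu * T1)\<bar> \<le> 4 * z * (10 / 1000)" by (rule abs_mult_mono2[OF ab(2)])
    then show ?thesis using sq z by linarith
  qed
  \<comment> \<open>\<open>k\<close> is the total coefficient with which the rotation of the
    eigenvector enters the two cutoffs. In the formula for \<open>LT\<close> only the term with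
    \<open>f2 * A\<close> has a numerator of order \<open>la\<close>, and the division by
    \<open>D\<close> removes this order.\<close>
  have t10: "- 40 * Q \<le> k * LT"
  proof -
    have LT: "LT = (f12 - f2 * A + f1 * B) / D - 2 * ((f1 * B) * (la / D) - f2 * T2) / D"
      unfolding LT_def T11 T22
      using linearised_operator_angle[OF _ _ e1 e2 e12, of D] D0 la0
      by (simp add: A_def B_def T2_def power2_eq_square diff_divide_distrib)
    have "\<bar>f2 * A\<bar> \<le> G * (2 * G * la)" "\<bar>f1 * B\<bar> \<le> G * (5 * z)"
      by (intro abs_mult_mono2 fd bd)+
    then have n1: "\<bar>f12 - f2 * A + f1 * B\<bar> \<le> G + 2 * G\<^sup>2 * la + 5 * (G * z)"
      using fd(4) by (simp add: power2_eq_square algebra_simps)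
    have "\<bar>T2\<bar> \<le> 1" using T2z sq mult_right_mono[OF sq(2) abs_ge_zero[of T2]] by linarith
    then have "\<bar>f2 * T2\<bar> \<le> G * 1" by (rule abs_mult_mono2[OF fd(2)])
    moreover have "\<bar>la / D\<bar> \<le> 2" using bd(1) D0 la0 by (simp add: field_simps)
    then have "\<bar>(f1 * B) * (la / D)\<bar> \<le> G * (5 * z) * 2"
      by (intro abs_mult_mono2 fd bd)
    then have "\<bar>(f1 * B) * (la / D)\<bar> \<le> 10 * (G * z)" by simp
    moreover have "\<bar>r - 2 * (e - g)\<bar> \<le> 28 * Q + 2 * G\<^sup>2 * la"
      if "\<bar>r\<bar> \<le> G + 2 * G\<^sup>2 * la + 5 * (G * z)" "\<bar>e\<bar> \<le> 10 * (G * z)" "\<bar>g\<bar> \<le> G * 1" for r e g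
      using that q unfolding abs_le_iff by auto
    ultimately have "\<bar>(f12 - f2 * A + f1 * B) - 2 * ((f1 * B) * (la / D) - f2 * T2)\<bar>
      \<le> 28 * Q + 2 * G\<^sup>2 * la" using n1 by blast
    then have "\<bar>LT\<bar> \<le> (28 * Q + 2 * G\<^sup>2 * la) / (la / 2)"
      unfolding LT diff_divide_distrib[symmetric] abs_divide
      using D0 bd(1) la0 by (intro frac_le) auto
    also have "\<dots> = 56 * Q / la + 4 * G\<^sup>2" using la0 by (simp add: field_simps)
    also have "56 * Q / la \<le> 1" using laQ la0 q by (simp add: field_simps)
    finally have "\<bar>LT\<bar> \<le> 5 * G\<^sup>2" using sq by linarith
    then have "\<bar>k * LT\<bar> \<le> 8 * z * (5 * G\<^sup>2)" by (rule abs_mult_mono2[OF k])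
    then show ?thesis using q(8) by (simp add: algebra_simps)
  qed
  \<comment> \<open>The quadratic rotation terms pull both coordinates towards 0, where the cutoffs
    are larger; hence the sign.\<close>
  have t11: "0 \<le> (- (a * x1) - b * x2) * (mu * T1\<^sup>2 + la * T2\<^sup>2)"
    using ab2 bd(3) la0 by (intro mult_nonneg_nonneg) auto
  have t12: "- G\<^sup>2 \<le> c * v1 * f1" "- G\<^sup>2 \<le> c * v2 * f2"
    using abs_mult_mono2[OF c(1) fd(1)] abs_mult_mono2[OF c(2) fd(2)]
    by (auto simp: power2_eq_square)
  have t13: "0 \<le> c * f * mu" "0 \<le> mu * A\<^sup>2" "0 \<le> 2 * (mu * u112\<^sup>2 + la * u122\<^sup>2) / (D * la)"
    using c f bd(3) la0 D0 by auto
  \<comment> \<open>The origin of the 5 in \<open>c = 5 / m\<close>: the cutoff costs at most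
    \<open>4 * la\<close>, so one full \<open>la\<close> remains.\<close>
  have "la * 1 \<le> la * (b\<^sup>2 + b2 + c * f)"
    using ab2(3) c(3) la0 by (intro mult_left_mono) auto
  then have t14: "la \<le> la * b\<^sup>2 + la * b2 + c * f * la" by (simp add: algebra_simps)
  \<comment> \<open>The individual losses add up to at most \<open>413 * Q\<close>.\<close>
  have "la - 500 * Q \<le> mu * ?I1 + la * ?I2"
    unfolding sum using t1 t2 t3 t4 t5 t6 t7 t8 t9 t10 t11 t12 t13 t14 q by linarith
  moreover have "mu * ?I1 \<le> 0" "la * ?I2 \<le> 0"
    using I1 I2 bd(3) la0 by (auto intro!: mult_nonneg_nonpos)
  ultimately show False using laQ q(1) by linarith
qed

section \<open>Derivatives of the equation in a frame\<close>

lemma Ck_on_has_derivative_dird: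
  assumes "open S" "Ck_on (Suc k) S w" "x \<in> S"
  shows "(w has_derivative (\<lambda>d. dird d w x)) (at x)"
  using Ck_on_has_derivative[OF assms(1,2,3)] unfolding dird_eq_grad .

lemma eventually_line_in_open:
  fixes x :: "'a::real_normed_vector"
  assumes "open S" "x \<in> S"
  shows "\<forall>\<^sub>F t in nhds 0. x + t *\<^sub>R d \<in> S"
proof -
  have "((\<lambda>t. x + t *\<^sub>R d) \<longlongrightarrow> x + 0 *\<^sub>R d) (nhds 0)"
    by (intro tendsto_intros filterlim_ident)
  from topological_tendstoD[OF this assms(1)] show ?thesis using assms(2) by simp
qed

lemma jet2_along_line:
  assumes S: "open S" and w: "Ck_on (Suc (Suc k)) S w" and x: "x \<in> S"
  shows "jet2 (\<lambda>t. w (x + t *\<^sub>R d)) (w x) (dird d w x) (dird d (dird d w) x)"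
proof (rule jet2I)
  show "\<forall>\<^sub>F t in nhds 0. ((\<lambda>t. w (x + t *\<^sub>R d)) has_real_derivative dird d w (x + t *\<^sub>R d)) (at t)"
    using eventually_line_in_open[OF S x, of d]
    by eventually_elim (rule has_real_derivative_along_line[OF S w])
  show "((\<lambda>t. dird d w (x + t *\<^sub>R d)) has_real_derivative dird d (dird d w) x) (at 0)"
    using has_real_derivative_along_line[OF S Ck_on_dird[OF S w], of x 0 d d] x by simp
qed auto

text \<open>Replaces derivatives by plain numbers. By the symmetry of repeated derivatives, the jets
  along \<open>d1\<close> and \<open>d2\<close> and the differentiated equation share one set of
  third and fourth order coefficients, so that \<open>no_critical_jet\<close> can be pure
  algebra.\<close>

lemma frame_jets:
  fixes U f :: "real^2 \<Rightarrow> real" and d1 d2 :: "real^2"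
  assumes S: "open S" and U: "Ck_on 4 S U" and f: "Ck_on 2 S f" and x: "x \<in> S"
  defines "U1 \<equiv> dird d1 U" and "U2 \<equiv> dird d2 U"
  defines "U11 \<equiv> dird d1 U1" and "U12 \<equiv> dird d2 U1" and "U22 \<equiv> dird d2 U2"
  assumes feq: "\<And>x. x \<in> S \<Longrightarrow> f x = U11 x * U22 x - (U12 x)\<^sup>2"
  obtains u111 u112 u122 u222 u1111 u1112 u1122 u1222 u2222 where
    "jet2 (\<lambda>t. U11 (x + t *\<^sub>R d1)) (U11 x) u111 u1111"
    "jet2 (\<lambda>t. U12 (x + t *\<^sub>R d1)) (U12 x) u112 u1112"
    "jet2 (\<lambda>t. U22 (x + t *\<^sub>R d1)) (U22 x) u122 u1122"
    "jet2 (\<lambda>t. U1 (x + t *\<^sub>R d1)) (U1 x) (U11 x) u111"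
    "jet2 (\<lambda>t. U2 (x + t *\<^sub>R d1)) (U2 x) (U12 x) u112"
    "jet2 (\<lambda>t. U11 (x + t *\<^sub>R d2)) (U11 x) u112 u1122"
    "jet2 (\<lambda>t. U12 (x + t *\<^sub>R d2)) (U12 x) u122 u1222"
    "jet2 (\<lambda>t. U22 (x + t *\<^sub>R d2)) (U22 x) u222 u2222"
    "jet2 (\<lambda>t. U1 (x + t *\<^sub>R d2)) (U1 x) (U12 x) u122"
    "jet2 (\<lambda>t. U2 (x + t *\<^sub>R d2)) (U2 x) (U22 x) u222"
    "dird d1 f x = u111 * U22 x + U11 x * u122 - 2 * U12 x * u112"
    "dird d2 f x = u112 * U22 x + U11 x * u222 - 2 * U12 x * u122"
    "dird d1 (dird d1 f) x = u1111 * U22 x + 2 * u111 * u122 + U11 x * u1122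
      - 2 * u112\<^sup>2 - 2 * U12 x * u1112"
    "dird d1 (dird d2 f) x = u1112 * U22 x + u112 * u122 + u111 * u222 + U11 x * u1222
      - 2 * u112 * u122 - 2 * U12 x * u1122"
proof -
  define U111 U112 U122 U222 where "U111 = dird d1 U11" and "U112 = dird d2 U11"
    and "U122 = dird d2 U12" and "U222 = dird d2 U22"
  have C4: "Ck_on (Suc 3) S U" and C2: "Ck_on (Suc 1) S f" using U f by (simp_all add: eval_nat_numeral)
  have C3: "Ck_on (Suc 2) S U1" "Ck_on (Suc 2) S U2"
    using Ck_on_dird[OF S C4] unfolding U1_def U2_def by (simp_all add: eval_nat_numeral)
  have C2': "Ck_on (Suc 1) S U11" "Ck_on (Suc 1) S U12" "Ck_on (Suc 1) S U22"
    using Ck_on_dird[OF S C3(1)] Ck_on_dird[OF S C3(2)]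
    unfolding U11_def U12_def U22_def by (simp_all add: eval_nat_numeral)
  have C1: "Ck_on (Suc 0) S U111" "Ck_on (Suc 0) S U112" "Ck_on (Suc 0) S U122" "Ck_on (Suc 0) S U222"
    using Ck_on_dird[OF S C2'(1)] Ck_on_dird[OF S C2'(2)] Ck_on_dird[OF S C2'(3)]
    unfolding U111_def U112_def U122_def U222_def by (simp_all add: eval_nat_numeral)
  have S4: "Ck_on (Suc (Suc 2)) S U" using C4 by (simp add: eval_nat_numeral)
  have S3: "Ck_on (Suc (Suc 1)) S U1" "Ck_on (Suc (Suc 1)) S U2" using C3 by (simp_all add: eval_nat_numeral)
  have S2: "Ck_on (Suc (Suc 0)) S U11" "Ck_on (Suc (Suc 0)) S U12" "Ck_on (Suc (Suc 0)) S U22"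
    using C2' by simp_all
  have c12: "dird d1 U2 y = U12 y" if "y \<in> S" for y
    unfolding U2_def U12_def U1_def by (rule dird_commute[OF S S4 that])
  have c112: "dird d1 U12 y = U112 y" if "y \<in> S" for y
    unfolding U112_def U12_def U11_def by (rule dird_commute[OF S S3(1) that])
  have c122: "dird d1 U22 y = U122 y" if "y \<in> S" for y
  proof -
    have "dird d1 U22 y = dird d2 (dird d1 U2) y"
      unfolding U22_def by (rule dird_commute[OF S S3(2) that])
    also have "\<dots> = U122 y"
      unfolding U122_def using S Ck_on_dird[OF S S3(2)] that c12 by (rule dird_cong)
    finally show ?thesis .
  qed
  have c1112: "dird d1 U112 y = dird d2 U111 y" if "y \<in> S" for y
    unfolding U112_def U111_def by (rule dird_commute[OF S S2(1) that])
  have c1122: "dird d1 U122 y = dird d2 U112 y" if "y \<in> S" for y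
  proof -
    have "dird d1 U122 y = dird d2 (dird d1 U12) y"
      unfolding U122_def by (rule dird_commute[OF S S2(2) that])
    also have "\<dots> = dird d2 U112 y"
      using S Ck_on_dird[OF S S2(2)] that c112 by (rule dird_cong)
    finally show ?thesis .
  qed
  have c1222: "dird d1 U222 y = dird d2 U122 y" if "y \<in> S" for y
  proof -
    have "dird d1 U222 y = dird d2 (dird d1 U22) y"
      unfolding U222_def by (rule dird_commute[OF S S2(3) that])
    also have "\<dots> = dird d2 U122 y"
      using S Ck_on_dird[OF S S2(3)] that c122 by (rule dird_cong)
    finally show ?thesis .
  qed
  have j: "jet2 (\<lambda>t. U11 (x + t *\<^sub>R d1)) (U11 x) (U111 x) (dird d1 U111 x)"
    "jet2 (\<lambda>t. U11 (x + t *\<^sub>R d2)) (U11 x) (U112 x) (dird d2 U112 x)"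
    "jet2 (\<lambda>t. U12 (x + t *\<^sub>R d2)) (U12 x) (U122 x) (dird d2 U122 x)"
    "jet2 (\<lambda>t. U22 (x + t *\<^sub>R d2)) (U22 x) (U222 x) (dird d2 U222 x)"
    "jet2 (\<lambda>t. U1 (x + t *\<^sub>R d1)) (U1 x) (U11 x) (U111 x)"
    "jet2 (\<lambda>t. U1 (x + t *\<^sub>R d2)) (U1 x) (U12 x) (U122 x)"
    "jet2 (\<lambda>t. U2 (x + t *\<^sub>R d2)) (U2 x) (U22 x) (U222 x)"
    using jet2_along_line[OF S S2(1) x] jet2_along_line[OF S S2(2) x] jet2_along_line[OF S S2(3) x]
      jet2_along_line[OF S S3(1) x] jet2_along_line[OF S S3(2) x]
    unfolding U111_def U112_def U122_def U222_def U11_def U12_def U22_def by blast+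
  have j2: "jet2 (\<lambda>t. U12 (x + t *\<^sub>R d1)) (U12 x) (U112 x) (dird d2 U111 x)"
  proof -
    have "dird d1 (dird d1 U12) x = dird d1 U112 x"
      using S Ck_on_dird[OF S S2(2)] x c112 by (rule dird_cong)
    then show ?thesis
      using jet2_along_line[OF S S2(2) x, of d1] c112[OF x] c1112[OF x] by simp
  qed
  have j3: "jet2 (\<lambda>t. U22 (x + t *\<^sub>R d1)) (U22 x) (U122 x) (dird d2 U112 x)"
  proof -
    have "dird d1 (dird d1 U22) x = dird d1 U122 x"
      using S Ck_on_dird[OF S S2(3)] x c122 by (rule dird_cong)
    then show ?thesis
      using jet2_along_line[OF S S2(3) x, of d1] c122[OF x] c1122[OF x] by simp
  qed
  have j4: "jet2 (\<lambda>t. U2 (x + t *\<^sub>R d1)) (U2 x) (U12 x) (U112 x)"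
  proof -
    have "dird d1 (dird d1 U2) x = dird d1 U12 x"
      using S Ck_on_dird[OF S S3(2)] x c12 by (rule dird_cong)
    then show ?thesis
      using jet2_along_line[OF S S3(2) x, of d1] c12[OF x] c112[OF x] by simp
  qed
  have hd2: "(U11 has_derivative (\<lambda>d. dird d U11 y)) (at y)" "(U12 has_derivative (\<lambda>d. dird d U12 y)) (at y)"
    "(U22 has_derivative (\<lambda>d. dird d U22 y)) (at y)" if "y \<in> S" for y
    using Ck_on_has_derivative_dird[OF S C2'(1) that] Ck_on_has_derivative_dird[OF S C2'(2) that]
      Ck_on_has_derivative_dird[OF S C2'(3) that] by auto
  have hd3: "(U111 has_derivative (\<lambda>d. dird d U111 y)) (at y)" "(U112 has_derivative (\<lambda>d. dird d U112 y)) (at y)"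
    "(U122 has_derivative (\<lambda>d. dird d U122 y)) (at y)" "(U222 has_derivative (\<lambda>d. dird d U222 y)) (at y)"
    if "y \<in> S" for y
    using Ck_on_has_derivative_dird[OF S C1(1) that] Ck_on_has_derivative_dird[OF S C1(2) that]
      Ck_on_has_derivative_dird[OF S C1(3) that] Ck_on_has_derivative_dird[OF S C1(4) that] by auto
  have df: "dird d f y = dird d U11 y * U22 y + U11 y * dird d U22 y - 2 * U12 y * dird d U12 y"
    if "y \<in> S" for d y
  proof -
    have "dird d f y = dird d (\<lambda>x. U11 x * U22 x - (U12 x)\<^sup>2) y"
      using S C2 that feq by (rule dird_cong)
    also have "((\<lambda>x. U11 x * U22 x - (U12 x)\<^sup>2) has_derivative
      (\<lambda>d. dird d U11 y * U22 y + U11 y * dird d U22 y - 2 * U12 y * dird d U12 y)) (at y)"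
      by (auto intro!: derivative_eq_intros hd2[OF that])
    note has_derivative_imp_dird[OF this, of d]
    finally show ?thesis .
  qed
  have df1: "dird d1 f y = U111 y * U22 y + U11 y * U122 y - 2 * U12 y * U112 y" if "y \<in> S" for y
    using df[OF that, of d1] c112[OF that] c122[OF that] by (simp add: U111_def)
  have df2: "dird d2 f y = U112 y * U22 y + U11 y * U222 y - 2 * U12 y * U122 y" if "y \<in> S" for y
    using df[OF that, of d2] by (simp add: U112_def U122_def U222_def)
  have df11: "dird d1 (dird d1 f) x = dird d1 U111 x * U22 x + 2 * U111 x * U122 x + U11 x * dird d2 U112 x
      - 2 * (U112 x)\<^sup>2 - 2 * U12 x * dird d2 U111 x"
  proof -
    have "dird d1 (dird d1 f) x = dird d1 (\<lambda>y. U111 y * U22 y + U11 y * U122 y - 2 * U12 y * U112 y) x"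
      using S Ck_on_dird[OF S C2] x df1 by (intro dird_cong[of S 0]) auto
    also have "((\<lambda>y. U111 y * U22 y + U11 y * U122 y - 2 * U12 y * U112 y) has_derivative
      (\<lambda>d. dird d U111 x * U22 x + U111 x * dird d U22 x + (dird d U11 x * U122 x + U11 x * dird d U122 x)
        - (2 * dird d U12 x * U112 x + 2 * U12 x * dird d U112 x))) (at x)"
      by (auto intro!: derivative_eq_intros hd2[OF x] hd3[OF x])
    note has_derivative_imp_dird[OF this, of d1]
    finally show ?thesis
      using c112[OF x] c122[OF x] c1112[OF x] c1122[OF x] by (simp add: U111_def power2_eq_square)
  qed
  have df12: "dird d1 (dird d2 f) x = dird d2 U111 x * U22 x + U112 x * U122 x + U111 x * U222 x
      + U11 x * dird d2 U122 x - 2 * U112 x * U122 x - 2 * U12 x * dird d2 U112 x"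
  proof -
    have "dird d1 (dird d2 f) x = dird d1 (\<lambda>y. U112 y * U22 y + U11 y * U222 y - 2 * U12 y * U122 y) x"
      using S Ck_on_dird[OF S C2] x df2 by (intro dird_cong[of S 0]) auto
    also have "((\<lambda>y. U112 y * U22 y + U11 y * U222 y - 2 * U12 y * U122 y) has_derivative
      (\<lambda>d. dird d U112 x * U22 x + U112 x * dird d U22 x + (dird d U11 x * U222 x + U11 x * dird d U222 x)
        - (2 * dird d U12 x * U122 x + 2 * U12 x * dird d U122 x))) (at x)"
      by (auto intro!: derivative_eq_intros hd2[OF x] hd3[OF x])
    note has_derivative_imp_dird[OF this, of d1]
    finally show ?thesis
      using c112[OF x] c122[OF x] c1112[OF x] c1122[OF x] c1222[OF x] by (simp add: U111_def)
  qed
  show ?thesis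
    by (rule that[OF j(1) j2 j3 j(5) j4 j(2,3,4,6,7) df1[OF x] df2[OF x] df11 df12])
qed

section \<open>The Hessian as a bilinear form, rotated frames and rescaling\<close>

definition rot :: "real^2 \<Rightarrow> real^2" where
  "rot v = vector [- v $ 2, v $ 1]"

lemma rot_nth [simp]: "rot v $ 1 = - v $ 2" "rot v $ 2 = v $ 1"
  by (simp_all add: rot_def)

lemma inner_real2: "(x::real^2) \<bullet> y = x $ 1 * y $ 1 + x $ 2 * y $ 2"
  by (simp add: inner_vec_def sum_2)

lemma norm_real2: "(norm (x::real^2))\<^sup>2 = (x $ 1)\<^sup>2 + (x $ 2)\<^sup>2"
  unfolding power2_norm_eq_inner inner_real2 by (simp add: power2_eq_square)

text \<open>A single mixed partial serves both off-diagonal entries, so the form is symmetric and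
  bilinear without any regularity of \<open>u\<close>.\<close>

definition bil :: "(real^2 \<Rightarrow> real) \<Rightarrow> real^2 \<Rightarrow> real^2 \<Rightarrow> real^2 \<Rightarrow> real" where
  "bil u x d e = d $ 1 * e $ 1 * pd 1 (pd 1 u) x + (d $ 1 * e $ 2 + d $ 2 * e $ 1) * pd 2 (pd 1 u) x
    + d $ 2 * e $ 2 * pd 2 (pd 2 u) x"

lemma pd_eq_dird: "pd i u = dird (axis i 1) u"
  using exhaust_2[of i] by (auto simp: dird_def axis_def)

lemma pd_commute:
  assumes "open S" "Ck_on (Suc (Suc k)) S u" "x \<in> S"
  shows "pd i (pd j u) x = pd j (pd i u) x"
  unfolding pd_eq_dird by (rule dird_commute[OF assms])

lemma dird_dird:
  assumes S: "open S" and u: "Ck_on (Suc (Suc k)) S u" and x: "x \<in> S"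
  shows "dird d (dird e u) x = bil u x d e"
proof -
  have "(pd i u has_derivative (\<lambda>d. dird d (pd i u) x)) (at x)" for i
    by (rule Ck_on_has_derivative_dird[OF S Ck_on_pd[OF S u] x])
  then have "(dird e u has_derivative (\<lambda>d. e $ 1 * dird d (pd 1 u) x + e $ 2 * dird d (pd 2 u) x)) (at x)"
    unfolding dird_def[of e u, abs_def] by (auto intro!: derivative_eq_intros)
  from has_derivative_imp_dird[OF this, of d] show ?thesis
    using pd_commute[OF assms, of 1 2] by (simp add: bil_def dird_def algebra_simps)
qed

text \<open>The Gram determinant of the form in the frame \<open>t\<close>, \<open>rot t\<close> is
  the Hessian determinant times the square of the frame's determinant \<open>|t|^2\<close>. The
  equation therefore looks the same in every such frame.\<close>

lemma det_hess:
  assumes "open S" "Ck_on (Suc (Suc k)) S u" "x \<in> S"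
    and "(t $ 1)\<^sup>2 + (t $ 2)\<^sup>2 = 1"
  shows "bil u x t t * bil u x (rot t) (rot t) - (bil u x t (rot t))\<^sup>2 = det (hess u x)"
proof -
  let ?a = "pd 1 (pd 1 u) x" and ?b = "pd 2 (pd 1 u) x" and ?c = "pd 2 (pd 2 u) x"
  have "bil u x t t * bil u x (rot t) (rot t) - (bil u x t (rot t))\<^sup>2
      = ((t $ 1)\<^sup>2 + (t $ 2)\<^sup>2)\<^sup>2 * (?a * ?c - ?b\<^sup>2)"
    unfolding bil_def rot_nth by (simp add: power2_eq_square algebra_simps)
  then show ?thesis
    using assms(4) pd_commute[OF assms(1-3), of 1 2]
    by (simp add: det_2 hess_def power2_eq_square)
qed

lemma Ck_on_cmult: "Ck_on k S w \<Longrightarrow> Ck_on k S (\<lambda>x. c * w x)"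
  using Ck_on_lincomb[of k S w w c 0] by simp

lemma dird_cmult:
  assumes "open S" "Ck_on (Suc k) S w" "x \<in> S"
  shows "dird d (\<lambda>x. c * w x) x = c * dird d w x"
  by (rule has_derivative_imp_dird[OF has_derivative_mult_right[OF Ck_on_has_derivative_dird[OF assms]]])

text \<open>The rescaling is done on the directions, not on the domain: dividing \<open>u\<close> by
  the square of \<open>r\<close> and stretching directions by \<open>r\<close> preserves the Hessian
  entries and divides the gradient by \<open>r\<close>.\<close>

lemma scaled_dird:
  assumes S: "open S" and u: "Ck_on (Suc (Suc k)) S u" and x: "x \<in> S" and r: "r \<noteq> 0"
  shows "dird (r *\<^sub>R e) (\<lambda>x. 1 / r\<^sup>2 * u x) x = 1 / r * dird e u x"
    and "dird (r *\<^sub>R d) (dird (r *\<^sub>R e) (\<lambda>x. 1 / r\<^sup>2 * u x)) x = bil u x d e"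
proof -
  have lin: "dird (r *\<^sub>R d) w y = r * dird d w y" for d w y
    by (simp add: dird_def algebra_simps)
  have 1: "dird (r *\<^sub>R e) (\<lambda>x. 1 / r\<^sup>2 * u x) y = 1 / r * dird e u y" if "y \<in> S" for y
    unfolding dird_cmult[OF S u that] lin using r by (simp add: power2_eq_square)
  then show "dird (r *\<^sub>R e) (\<lambda>x. 1 / r\<^sup>2 * u x) x = 1 / r * dird e u x" using x by blast
  have "dird (r *\<^sub>R d) (dird (r *\<^sub>R e) (\<lambda>x. 1 / r\<^sup>2 * u x)) x = dird (r *\<^sub>R d) (\<lambda>y. 1 / r * dird e u y) x"
    using S Ck_on_dird[OF S Ck_on_cmult[OF u]] x 1 by (rule dird_cong)
  also have "\<dots> = bil u x d e"
    unfolding dird_cmult[OF S Ck_on_dird[OF S u] x] lin using r by (simp add: dird_dird[OF S u x])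
  finally show "dird (r *\<^sub>R d) (dird (r *\<^sub>R e) (\<lambda>x. 1 / r\<^sup>2 * u x)) x = bil u x d e" .
qed

text \<open>By the double angle formulas, \<open>tan (2 * th) = 2 * q / (p - s)\<close> says exactly
  that the off-diagonal entry vanishes in the frame rotated by \<open>th\<close>.\<close>

lemma eig_angle_eigen:
  assumes "s t < p t"
  shows "q t * ((cos (eig_angle p q s t))\<^sup>2 - (sin (eig_angle p q s t))\<^sup>2)
    = (p t - s t) * (sin (eig_angle p q s t) * cos (eig_angle p q s t))"
proof -
  define al where "al = arctan (2 * q t / (p t - s t))"
  have half: "eig_angle p q s t = al / 2" by (simp add: eig_angle_def al_def)
  have "cos al \<noteq> 0" by (simp add: al_def)
  moreover have "tan al = 2 * q t / (p t - s t)" by (simp add: al_def tan_arctan)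
  ultimately have "sin al * (p t - s t) = 2 * q t * cos al"
    using assms by (simp add: tan_def field_simps)
  moreover have "sin al = 2 * sin (al / 2) * cos (al / 2)" "cos al = (cos (al / 2))\<^sup>2 - (sin (al / 2))\<^sup>2"
    using sin_double[of "al / 2"] cos_double[of "al / 2"] by simp_all
  ultimately show ?thesis unfolding half by (simp add: algebra_simps)
qed

section \<open>The maximum principle argument\<close>

text \<open>\<open>a\<close> and \<open>a2\<close> are the first two derivatives of \<open>2 ln (1 - x\<^sup>2)\<close>; \<open>a\<^sup>2 + a2\<close> is bounded below
  because \<open>(1 - x\<^sup>2)\<^sup>2\<close> is convex near its zeros.\<close>

lemma cutoff_bounds:
  fixes x z :: real
  assumes "\<bar>x\<bar> < 1" "1 / (1 - x\<^sup>2) \<le> z"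
  defines "a \<equiv> - 4 * x / (1 - x\<^sup>2)" and "a2 \<equiv> - 4 * (1 + x\<^sup>2) / (1 - x\<^sup>2)\<^sup>2"
  shows "\<bar>a\<bar> \<le> 4 * z" "\<bar>a2\<bar> \<le> 8 * z\<^sup>2" "- 4 \<le> a\<^sup>2 + a2" "a * x \<le> 0"
proof -
  define e where "e = 1 - x\<^sup>2"
  have e: "0 < e" using assms(1) by (simp add: e_def abs_square_less_1)
  have z: "1 / e \<le> z" using assms(2) by (simp add: e_def)
  have x2: "x\<^sup>2 \<le> 1" using e by (simp add: e_def)
  have "\<bar>a\<bar> = 4 * \<bar>x\<bar> * (1 / e)" using e by (simp add: a_def e_def[symmetric] abs_mult)
  also have "\<dots> \<le> 4 * z" using assms(1) e z by (intro mult_mono) auto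
  finally show "\<bar>a\<bar> \<le> 4 * z" .
  have "\<bar>a2\<bar> = 4 * (1 + x\<^sup>2) * (1 / e)\<^sup>2"
    unfolding a2_def e_def[symmetric] abs_divide abs_mult by (simp add: power_divide)
  also have "\<dots> \<le> 8 * z\<^sup>2"
    using x2 e z by (intro mult_mono power_mono) auto
  finally show "\<bar>a2\<bar> \<le> 8 * z\<^sup>2" .
  \<comment> \<open>This is \<open>zeta'' / zeta\<close> for \<open>zeta = (1 - x^2)^2\<close>,
    since the logarithm of \<open>zeta\<close> has derivatives \<open>a\<close> and
    \<open>a2\<close>.\<close>
  have "a\<^sup>2 + a2 = (12 * x\<^sup>2 - 4) / e\<^sup>2"
    unfolding a_def a2_def e_def[symmetric] by (simp add: power_divide add_divide_distrib[symmetric] algebra_simps)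
  moreover have "- 4 * e\<^sup>2 \<le> 12 * x\<^sup>2 - 4"
  proof -
    have "12 * x\<^sup>2 - 4 - (- 4 * e\<^sup>2) = 4 * x\<^sup>2 + 4 * (x\<^sup>2)\<^sup>2"
      unfolding e_def by (simp add: power2_eq_square algebra_simps)
    moreover have "0 \<le> 4 * x\<^sup>2 + 4 * (x\<^sup>2)\<^sup>2" by simp
    ultimately show ?thesis by linarith
  qed
  ultimately show "- 4 \<le> a\<^sup>2 + a2" using e by (simp add: pos_le_divide_eq)
  show "a * x \<le> 0" using e by (simp add: a_def e_def[symmetric] divide_nonpos_pos)
qed

lemma bil_bilinear:
  "bil u x (a *\<^sub>R v + b *\<^sub>R w) (a' *\<^sub>R v + b' *\<^sub>R w)
    = a * a' * bil u x v v + (a * b' + b * a') * bil u x v w + b * b' * bil u x w w"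
  by (simp add: bil_def algebra_simps)

lemma bil_commute: "bil u x d e = bil u x e d"
  by (simp add: bil_def algebra_simps)

lemma bil_scaleR: "bil u x (r *\<^sub>R d) (s *\<^sub>R e) = r * s * bil u x d e"
  by (simp add: bil_def algebra_simps)

lemma abs_bil_le_mat_norm:
  assumes "open S" "Ck_on (Suc (Suc k)) S u" "x \<in> S" "norm d = 1" "norm e = 1"
  shows "\<bar>bil u x d e\<bar> \<le> mat_norm (hess u x)"
proof -
  have "bil u x d e = d \<bullet> (hess u x *v e)"
    using pd_commute[OF assms(1-3), of 1 2]
    by (simp add: bil_def inner_real2 hess_def matrix_vector_mult_def sum_2 algebra_simps)
  also have "\<bar>\<dots>\<bar> \<le> norm d * norm (hess u x *v e)" by (rule Cauchy_Schwarz_ineq2)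
  also have "norm (hess u x *v e) \<le> mat_norm (hess u x) * norm e"
    unfolding mat_norm_def by (rule onorm) (rule matrix_vector_mul_bounded_linear)
  finally show ?thesis using assms by simp
qed

lemma rot_lincomb: "rot (a *\<^sub>R t + b *\<^sub>R rot t) = a *\<^sub>R rot t - b *\<^sub>R t"
  by (simp add: vec_eq_iff forall_2)

lemma norm_frame:
  assumes "norm t = 1"
  shows "(x \<bullet> t)\<^sup>2 + (x \<bullet> rot t)\<^sup>2 = (norm x)\<^sup>2"
proof -
  have t: "(t $ 1)\<^sup>2 + (t $ 2)\<^sup>2 = 1" using norm_real2[of t] assms by simp
  have "(x \<bullet> t)\<^sup>2 + (x \<bullet> rot t)\<^sup>2 = ((t $ 1)\<^sup>2 + (t $ 2)\<^sup>2) * ((x $ 1)\<^sup>2 + (x $ 2)\<^sup>2)"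
    unfolding inner_real2 rot_nth by (simp add: power2_eq_square algebra_simps)
  then show ?thesis using t norm_real2[of x] by simp
qed

text \<open>Pairs of a point and a unit eigenvector of the Hessian there, with eigenvalue at least \<open>L\<close>.
  The bounds on \<open>x \<bullet> t\<close> and \<open>x \<bullet> rot t\<close> confine \<open>x\<close> to the ball of radius \<open>sqrt 2 * r\<close>.
  Maximising over pairs, rather than over points with a chosen eigenvector, avoids having to
  select the eigenvector continuously where the eigenvalues coincide.\<close>

definition eig_set :: "(real^2 \<Rightarrow> real) \<Rightarrow> real \<Rightarrow> real \<Rightarrow> real \<Rightarrow> ((real^2) \<times> (real^2)) set" where
  "eig_set u R r L = {(x, t). x \<in> ball 0 R \<and> norm t = 1 \<and> \<bar>x \<bullet> t\<bar> \<le> r \<and> \<bar>x \<bullet> rot t\<bar> \<le> r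
     \<and> bil u x t (rot t) = 0 \<and> L \<le> bil u x t t}"

definition weight :: "(real^2 \<Rightarrow> real) \<Rightarrow> real \<Rightarrow> real \<Rightarrow> real^2 \<Rightarrow> real^2 \<Rightarrow> real" where
  "weight u r c x t = bil u x t t * ((1 - (x \<bullet> t / r)\<^sup>2) * (1 - (x \<bullet> rot t / r)\<^sup>2))\<^sup>2
     * exp (c / 2 * ((norm (grad u x))\<^sup>2 / r\<^sup>2))"

lemma continuous_on_weight_bil:
  assumes u: "Ck_on (Suc (Suc k)) (ball 0 R) u" and sub: "fst ` A \<subseteq> ball 0 R"
  shows "continuous_on A (\<lambda>y. bil u (fst y) (snd y) (snd y))"
    "continuous_on A (\<lambda>y. bil u (fst y) (snd y) (rot (snd y)))"
    "continuous_on A (\<lambda>y. weight u r c (fst y) (snd y))"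
proof -
  have pd: "continuous_on (ball 0 R) (pd i (pd j u))" "continuous_on (ball 0 R) (pd i u)" for i j
    using Ck_on_continuous_on Ck_on_pd[OF open_ball u] Ck_on_pd[OF open_ball Ck_on_pd[OF open_ball u]] by blast+
  have pd': "continuous_on A (\<lambda>y. pd i (pd j u) (fst y))" "continuous_on A (\<lambda>y. pd i u (fst y))" for i j
    using continuous_on_compose2[OF pd(1) continuous_on_fst[OF continuous_on_id] sub]
      continuous_on_compose2[OF pd(2) continuous_on_fst[OF continuous_on_id] sub] by auto
  show b: "continuous_on A (\<lambda>y. bil u (fst y) (snd y) (snd y))"
    unfolding bil_def by (intro continuous_intros pd')
  show "continuous_on A (\<lambda>y. bil u (fst y) (snd y) (rot (snd y)))"
    unfolding bil_def rot_nth by (intro continuous_intros pd')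
  show "continuous_on A (\<lambda>y. weight u r c (fst y) (snd y))"
    unfolding weight_def inner_real2 rot_nth norm_real2 grad_def vec_lambda_beta divide_inverse
    by (intro continuous_intros pd' b)
qed

lemma compact_eig_set:
  assumes u: "Ck_on (Suc (Suc k)) (ball 0 R) u" and R: "0 < R" and r: "r = R / 2"
  shows "compact (eig_set u R r L)"
proof -
  \<comment> \<open>The coordinate bounds give \<open>norm x <= R / sqrt 2\<close>, and
    \<open>3/4\<close> lies between \<open>1 / sqrt 2\<close> and 1. Thus \<open>A\<close> is a
    compact set over the open ball that contains \<open>eig_set\<close>, and the Hessian is
    continuous on it.\<close>
  define A where "A = (cball 0 (3/4 * R) :: (real^2) set) \<times> (sphere 0 1 :: (real^2) set)"
  define F where "F = (\<lambda>y. (fst y \<bullet> snd y, fst y \<bullet> rot (snd y), bil u (fst y) (snd y) (rot (snd y)),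
    bil u (fst y) (snd y) (snd y)))"
  define T where "T = {-r..r} \<times> {-r..r} \<times> {0::real} \<times> {L..}"
  have sub: "fst ` A \<subseteq> ball 0 R" using R by (auto simp: A_def)
  have A: "compact A" unfolding A_def by (intro compact_Times compact_cball compact_sphere)
  have "continuous_on A F"
    unfolding F_def inner_real2 rot_nth
    by (intro continuous_on_Pair continuous_on_weight_bil[OF u sub] continuous_intros)
  moreover have "closed T" unfolding T_def by (intro closed_Times) auto
  ultimately have "closed (A \<inter> F -` T)"
    using compact_imp_closed[OF A] continuous_closed_preimage by blast
  then have "compact (A \<inter> (A \<inter> F -` T))" using A compact_Int_closed by blast
  moreover have "eig_set u R r L = A \<inter> (A \<inter> F -` T)"
  proof (intro equalityI subsetI)
    fix y assume "y \<in> eig_set u R r L"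
    then obtain x t where y: "y = (x, t)" and E: "norm t = 1" "\<bar>x \<bullet> t\<bar> \<le> r" "\<bar>x \<bullet> rot t\<bar> \<le> r"
      "bil u x t (rot t) = 0" "L \<le> bil u x t t" unfolding eig_set_def by auto
    have "(x \<bullet> t)\<^sup>2 \<le> r\<^sup>2" "(x \<bullet> rot t)\<^sup>2 \<le> r\<^sup>2"
      using power_mono[OF E(2), of 2] power_mono[OF E(3), of 2] by auto
    then have "(norm x)\<^sup>2 \<le> R\<^sup>2 / 2"
      using norm_frame[OF E(1), of x] by (simp add: r power_divide)
    also have "\<dots> \<le> (3/4 * R)\<^sup>2" by (simp add: power_mult_distrib power_divide)
    finally have "norm x \<le> 3/4 * R" by (rule power2_le_imp_le) (use R in simp)
    then show "y \<in> A \<inter> (A \<inter> F -` T)"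
      using E by (auto simp: y A_def F_def T_def abs_le_iff)
  next
    fix y assume "y \<in> A \<inter> (A \<inter> F -` T)"
    then show "y \<in> eig_set u R r L"
      using sub unfolding eig_set_def by (auto simp: A_def F_def T_def abs_le_iff)
  qed
  ultimately show ?thesis by simp
qed

text \<open>Rotating the frame by the eigenvector angle keeps the pair of point and direction in
  \<open>eig_set\<close>. So \<open>test_fun\<close> is the logarithm of \<open>weight\<close> along
  a curve of admissible pairs, and maximality over the set can be tested on it.\<close>

lemma test_fun_eq_ln_weight:
  fixes u :: "real^2 \<Rightarrow> real" and t0 x0 :: "real^2" and k1 k2 r R c L t X1 X2 :: real
    and p q s v1 v2 th y1 y2 :: "real \<Rightarrow> real"
  assumes r: "0 < r" and t0: "norm t0 = 1"
    and d_def: "d = (k1 *\<^sub>R (r *\<^sub>R t0) + k2 *\<^sub>R (r *\<^sub>R rot t0))"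
  assumes p_def: "p = (\<lambda>t. bil u (x0 + t *\<^sub>R d) t0 t0)" and q_def: "q = (\<lambda>t. bil u (x0 + t *\<^sub>R d) t0 (rot t0))"
    and s_def: "s = (\<lambda>t. bil u (x0 + t *\<^sub>R d) (rot t0) (rot t0))"
    and v1_def: "v1 = (\<lambda>t. 1 / r * dird t0 u (x0 + t *\<^sub>R d))" and v2_def: "v2 = (\<lambda>t. 1 / r * dird (rot t0) u (x0 + t *\<^sub>R d))"
    and X1_def: "X1 = (x0 \<bullet> t0 / r)" and X2_def: "X2 = (x0 \<bullet> rot t0 / r)"
  assumes th_def: "th = (eig_angle p q s)"
  assumes y1_def: "y1 = (\<lambda>t. (X1 + k1 * t) * cos (th t) + (X2 + k2 * t) * sin (th t))"
    and y2_def: "y2 = (\<lambda>t. (X2 + k2 * t) * cos (th t) - (X1 + k1 * t) * sin (th t))"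
  assumes tau_def: "tau = (\<lambda>t. cos (th t) *\<^sub>R t0 + sin (th t) *\<^sub>R rot t0)"
  assumes cond: "x0 + t *\<^sub>R d \<in> ball 0 R" "s t < p t" "\<bar>y1 t\<bar> < 1" "\<bar>y2 t\<bar> < 1" "L \<le> eig_val p q s t" "0 < L"
  shows "(x0 + t *\<^sub>R d, tau t) \<in> eig_set u R r L"
    and "0 < weight u r c (x0 + t *\<^sub>R d) (tau t)"
    and "test_fun c p q s v1 v2 X1 k1 X2 k2 t = ln (weight u r c (x0 + t *\<^sub>R d) (tau t))"
proof -
  define x C Sn where "x = x0 + t *\<^sub>R d" and "C = cos (th t)" and "Sn = sin (th t)"
  have CS: "C\<^sup>2 + Sn\<^sup>2 = 1" by (simp add: C_def Sn_def)
  have t0': "(t0 $ 1)\<^sup>2 + (t0 $ 2)\<^sup>2 = 1" using norm_real2[of t0] t0 by simp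
  have in0: "t0 \<bullet> t0 = 1" "t0 \<bullet> rot t0 = 0" "rot t0 \<bullet> t0 = 0" "rot t0 \<bullet> rot t0 = 1"
    using t0' by (simp_all add: inner_real2 power2_eq_square)
  have tau: "tau t = C *\<^sub>R t0 + Sn *\<^sub>R rot t0" by (simp add: tau_def C_def Sn_def)
  have rtau: "rot (tau t) = C *\<^sub>R rot t0 - Sn *\<^sub>R t0" unfolding tau by (rule rot_lincomb)
  have rtau': "rot (tau t) = (- Sn) *\<^sub>R t0 + C *\<^sub>R rot t0" unfolding rtau by simp
  have "(norm (tau t))\<^sup>2 = 1"
    unfolding power2_norm_eq_inner tau using in0 CS by (simp add: inner_add_left inner_add_right power2_eq_square)
  then have ntau: "norm (tau t) = 1" using norm_ge_zero[of "tau t"] by (auto simp: power2_eq_1_iff)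
  have xt: "x \<bullet> t0 = r * (X1 + k1 * t)" "x \<bullet> rot t0 = r * (X2 + k2 * t)"
    using r unfolding x_def d_def X1_def X2_def
    by (simp_all add: inner_add_left in0 algebra_simps)
  have y: "x \<bullet> tau t = r * y1 t" "x \<bullet> rot (tau t) = r * y2 t"
    subgoal unfolding tau y1_def
      by (simp add: inner_add_right xt C_def[symmetric] Sn_def[symmetric] algebra_simps)
    subgoal unfolding rtau y2_def
      by (simp add: inner_diff_right xt C_def[symmetric] Sn_def[symmetric] algebra_simps)
    done
  have ab: "\<bar>x \<bullet> tau t\<bar> \<le> r" "\<bar>x \<bullet> rot (tau t)\<bar> \<le> r"
    using cond(3,4) r by (simp_all add: y abs_mult)
  have w: "bil u x (tau t) (tau t) = eig_val p q s t"
    unfolding tau bil_bilinear eig_val_def th_def[symmetric] C_def[symmetric] Sn_def[symmetric]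
    by (simp add: p_def q_def s_def x_def power2_eq_square algebra_simps)
  have eig: "q t * (C\<^sup>2 - Sn\<^sup>2) = (p t - s t) * (Sn * C)"
    using eig_angle_eigen[of s t p q] cond(2) by (simp add: th_def C_def Sn_def)
  have "bil u x (tau t) (rot (tau t)) = q t * (C\<^sup>2 - Sn\<^sup>2) - (p t - s t) * (Sn * C)"
    unfolding rtau' unfolding tau bil_bilinear
    by (simp add: p_def q_def s_def x_def power2_eq_square algebra_simps)
  then have "bil u x (tau t) (rot (tau t)) = 0" using eig by simp
  then show "(x0 + t *\<^sub>R d, tau t) \<in> eig_set u R r L"
    unfolding eig_set_def x_def[symmetric] using cond ntau ab w by (simp add: x_def)
  have g: "(norm (grad u x))\<^sup>2 / r\<^sup>2 = (v1 t)\<^sup>2 + (v2 t)\<^sup>2"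
    unfolding norm_frame[OF t0, symmetric] v1_def v2_def dird_eq_grad x_def
    by (simp add: power_divide add_divide_distrib)
  have yr: "x \<bullet> tau t / r = y1 t" "x \<bullet> rot (tau t) / r = y2 t" using r y by simp_all
  have wt: "weight u r c x (tau t) = eig_val p q s t * ((1 - (y1 t)\<^sup>2) * (1 - (y2 t)\<^sup>2))\<^sup>2
      * exp (c / 2 * ((v1 t)\<^sup>2 + (v2 t)\<^sup>2))"
    unfolding weight_def g yr w by simp
  have pos: "0 < eig_val p q s t" "0 < 1 - (y1 t)\<^sup>2" "0 < 1 - (y2 t)\<^sup>2"
    using cond by (auto simp: abs_square_less_1)
  show "0 < weight u r c (x0 + t *\<^sub>R d) (tau t)"
    unfolding x_def[symmetric] wt using pos by simp
  show "test_fun c p q s v1 v2 X1 k1 X2 k2 t = ln (weight u r c (x0 + t *\<^sub>R d) (tau t))"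
    unfolding x_def[symmetric] wt using pos
    by (simp add: test_fun_def y1_def[symmetric] y2_def[symmetric] th_def[symmetric] ln_mult ln_realpow)
      (simp add: y1_def y2_def)
qed

lemma eigenvalue_estimate:
  fixes u f :: "real^2 \<Rightarrow> real"
  assumes R: "0 < R" and u: "Ck_on 4 (ball 0 R) u" and f: "Ck_on 2 (ball 0 R) f"
    and det: "\<And>x. x \<in> ball 0 R \<Longrightarrow> det (hess u x) = f x"
    and m: "0 < m" and fm: "\<And>x. x \<in> ball 0 R \<Longrightarrow> m \<le> f x" and fG: "\<And>x. x \<in> ball 0 R \<Longrightarrow> f x \<le> G"
    and r: "r = R / 2"
    and uK: "\<And>x. x \<in> ball 0 R \<Longrightarrow> norm (grad u x) \<le> r * K"
    and f1: "\<And>x. x \<in> ball 0 R \<Longrightarrow> r * norm (grad f x) \<le> G"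
    and f2: "\<And>x. x \<in> ball 0 R \<Longrightarrow> r\<^sup>2 * mat_norm (hess f x) \<le> G"
    and G: "1 \<le> G" "5 / m * K \<le> G"
    and t: "norm t = 1" "bil u 0 t (rot t) = 0"
  shows "bil u 0 t t \<le> 1000 * G\<^sup>2 * exp (5 / m / 2 * K\<^sup>2)"
proof (rule ccontr)
  assume "\<not> ?thesis"
  then have big: "1000 * G\<^sup>2 * exp (5 / m / 2 * K\<^sup>2) < bil u 0 t t" by simp
  define c where "c = 5 / m"
  have c: "0 < c" using m by (simp add: c_def)
  have r0: "0 < r" using R r by simp
  have S: "open (ball (0::real^2) R)" by simp
  have u2: "Ck_on (Suc (Suc 2)) (ball 0 R) u" and f2': "Ck_on (Suc (Suc 0)) (ball 0 R) f"
    using u f by (simp_all add: eval_nat_numeral)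
  have G2: "1 \<le> G\<^sup>2" "G \<le> G\<^sup>2" using G by (auto simp: one_le_power self_le_power)
  \<comment> \<open>The threshold is half of the lower bound \<open>la_G\<close> found below for the
    eigenvalue at the maximum, so it is not an active constraint there.\<close>
  define E where "E = eig_set u R r (500 * G\<^sup>2)"
  have e1: "1 \<le> exp (c / 2 * y)" if "0 \<le> y" for y using c that by simp
  have "500 * G\<^sup>2 \<le> 1000 * G\<^sup>2 * 1" by simp
  also have "\<dots> \<le> 1000 * G\<^sup>2 * exp (c / 2 * K\<^sup>2)" by (intro mult_left_mono e1) auto
  finally have 0: "(0, t) \<in> E"
    using big R t r0 unfolding E_def eig_set_def c_def by simp
  have "compact E" unfolding E_def by (rule compact_eig_set[OF u2 R r])
  moreover have "continuous_on E (\<lambda>y. weight u r c (fst y) (snd y))"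
    by (rule continuous_on_weight_bil[OF u2]) (auto simp: E_def eig_set_def)
  ultimately obtain y where y: "y \<in> E" "\<And>y'. y' \<in> E \<Longrightarrow> weight u r c (fst y') (snd y') \<le> weight u r c (fst y) (snd y)"
    using continuous_attains_sup[of E "\<lambda>y. weight u r c (fst y) (snd y)"] 0 by blast
  obtain x0 t0 where y_eq: "y = (x0, t0)" by fastforce
  have max: "weight u r c x s \<le> weight u r c x0 t0" if "(x, s) \<in> E" for x s
    using y(2)[OF that] by (simp add: y_eq)
  have E0: "x0 \<in> ball 0 R" "norm t0 = 1" "\<bar>x0 \<bullet> t0\<bar> \<le> r" "\<bar>x0 \<bullet> rot t0\<bar> \<le> r"
    "bil u x0 t0 (rot t0) = 0" "500 * G\<^sup>2 \<le> bil u x0 t0 t0"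
    using y(1) by (auto simp: y_eq E_def eig_set_def)
  define la mu X1 X2 h1 h2 where "la = bil u x0 t0 t0" and "mu = bil u x0 (rot t0) (rot t0)"
    and "X1 = x0 \<bullet> t0 / r" and "X2 = x0 \<bullet> rot t0 / r"
    and "h1 = 1 - X1\<^sup>2" and "h2 = 1 - X2\<^sup>2"
  have "\<bar>X1\<bar> \<le> 1" "\<bar>X2\<bar> \<le> 1" using E0(3,4) r0 by (simp_all add: X1_def X2_def)
  then have h: "0 \<le> h1" "h1 \<le> 1" "0 \<le> h2" "h2 \<le> 1"
    by (simp_all add: h1_def h2_def abs_square_le_1)
  have la0: "500 \<le> la" using E0(6) G2 unfolding la_def by linarith
  \<comment> \<open>Comparison with the origin, where both cutoffs equal 1. The gradient factor is
    at least 1 at the origin and at most \<open>exp (c / 2 * K^2)\<close> at the maximum, which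
    leaves \<open>la_h\<close>. As a consequence the cutoffs do not vanish at the maximum.\<close>
  have "bil u 0 t t * 1 \<le> bil u 0 t t * exp (c / 2 * ((norm (grad u 0))\<^sup>2 / r\<^sup>2))"
  proof (rule mult_left_mono[OF e1])
    have "0 \<le> 1000 * G\<^sup>2 * exp (5 / m / 2 * K\<^sup>2)" by simp
    then show "0 \<le> bil u 0 t t" using big by linarith
  qed simp
  also have "\<dots> = weight u r c 0 t" by (simp add: weight_def)
  also have "\<dots> \<le> weight u r c x0 t0" by (rule max[OF 0])
  also have "\<dots> = la * (h1 * h2)\<^sup>2 * exp (c / 2 * ((norm (grad u x0))\<^sup>2 / r\<^sup>2))"
    by (simp add: weight_def la_def h1_def h2_def X1_def X2_def)
  also have "\<dots> \<le> la * (h1 * h2)\<^sup>2 * exp (c / 2 * K\<^sup>2)"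
  proof -
    have "(norm (grad u x0))\<^sup>2 \<le> (r * K)\<^sup>2" using uK[OF E0(1)] by (intro power_mono) auto
    then have "(norm (grad u x0))\<^sup>2 / r\<^sup>2 \<le> K\<^sup>2" using r0 by (simp add: field_simps power_mult_distrib)
    then have "c / 2 * ((norm (grad u x0))\<^sup>2 / r\<^sup>2) \<le> c / 2 * K\<^sup>2"
      using c by (intro mult_left_mono) auto
    then have "exp (c / 2 * ((norm (grad u x0))\<^sup>2 / r\<^sup>2)) \<le> exp (c / 2 * K\<^sup>2)" by (simp only: exp_le_cancel_iff)
    then show ?thesis using la0 by (intro mult_left_mono) auto
  qed
  finally have "1000 * G\<^sup>2 * exp (c / 2 * K\<^sup>2) < la * (h1 * h2)\<^sup>2 * exp (c / 2 * K\<^sup>2)"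
    using big unfolding c_def[symmetric] by linarith
  then have la_h: "1000 * G\<^sup>2 < la * (h1 * h2)\<^sup>2" by (rule mult_right_less_imp_less) simp
  have hpos: "0 < h1" "0 < h2"
    using la_h G2 h by (auto simp: less_le)
  have X: "\<bar>X1\<bar> < 1" "\<bar>X2\<bar> < 1" using hpos by (simp_all add: h1_def h2_def abs_square_less_1)
  \<comment> \<open>With this \<open>z\<close> the inequality \<open>la_h\<close> becomes the
    largeness hypothesis of \<open>no_critical_jet\<close>.\<close>
  define z where "z = 1 / (h1 * h2)"
  have hh: "0 < h1 * h2" "h1 * h2 \<le> h1" "h1 * h2 \<le> h2" "h1 * h2 \<le> 1"
    using hpos h by (auto simp: mult_le_cancel_left1 mult_le_cancel_right1 intro: mult_le_one)
  have z: "1 \<le> z" "1 / h1 \<le> z" "1 / h2 \<le> z"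
    using hh hpos unfolding z_def by (auto intro!: frac_le simp: le_divide_eq)
  have la_z: "1000 * G\<^sup>2 * z\<^sup>2 \<le> la"
    using la_h hh(1) zero_less_power[OF hh(1), of 2] unfolding z_def
    by (simp add: power_divide pos_divide_le_eq)
  have "1000 * G\<^sup>2 * 1 \<le> 1000 * G\<^sup>2 * z\<^sup>2" using z by (intro mult_left_mono one_le_power) auto
  then have la_G: "1000 * G\<^sup>2 \<le> la" using la_z by linarith
  have t0: "(t0 $ 1)\<^sup>2 + (t0 $ 2)\<^sup>2 = 1" using norm_real2[of t0] E0(2) by simp
  have nrot: "norm (rot t0) = 1" using norm_real2[of "rot t0"] t0 norm_ge_zero[of "rot t0"]
    by (auto simp: power2_eq_1_iff add.commute)
  have dt: "bil u x t0 t0 * bil u x (rot t0) (rot t0) - (bil u x t0 (rot t0))\<^sup>2 = f x" if "x \<in> ball 0 R" for x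
    using det_hess[OF S u2 that t0] det[OF that] by simp
  have lamu: "la * mu = f x0" using dt[OF E0(1)] E0(5) by (simp add: la_def mu_def)
  have f0: "0 < f x0" "f x0 \<le> G" using fm[OF E0(1)] fG[OF E0(1)] m by auto
  \<comment> \<open>The determinant is at most \<open>G\<close> while \<open>la\<close> is at least
    \<open>1000 * G^2\<close>, so the eigenvalues are strictly separated; this makes the eigenvector
    angle differentiable at the maximum.\<close>
  have mu: "mu = f x0 / la" using lamu la0 by (simp add: field_simps)
  also have "\<dots> \<le> G / la" using f0 la0 by (intro divide_right_mono) auto
  also have "\<dots> \<le> 1" using la_G G2 la0 by (simp add: field_simps)
  finally have mula: "mu < la" using la0 by linarith

  define d1 d2 U where "d1 = r *\<^sub>R t0" and "d2 = r *\<^sub>R rot t0" and "U = (\<lambda>x. 1 / r\<^sup>2 * u x)"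
  have U: "Ck_on 4 (ball 0 R) U" unfolding U_def by (rule Ck_on_cmult[OF u])
  have rne: "r \<noteq> 0" using r0 by simp
  note sd = scaled_dird[OF S u2 _ rne, folded U_def]
  have Ub: "dird d1 U x = 1 / r * dird t0 u x" "dird d2 U x = 1 / r * dird (rot t0) u x"
    "dird d1 (dird d1 U) x = bil u x t0 t0" "dird d2 (dird d1 U) x = bil u x t0 (rot t0)"
    "dird d2 (dird d2 U) x = bil u x (rot t0) (rot t0)" if "x \<in> ball 0 R" for x
    using sd[OF that] bil_commute[of u x "rot t0" t0] unfolding d1_def d2_def by auto
  have feq: "f x = dird d1 (dird d1 U) x * dird d2 (dird d2 U) x - (dird d2 (dird d1 U) x)\<^sup>2" if "x \<in> ball 0 R" for x
    using dt[OF that] Ub[OF that] by simp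
  note in_ball = eventually_line_in_open[OF S E0(1)]
  obtain u111 u112 u122 u222 u1111 u1112 u1122 u1222 u2222 where
    J: "jet2 (\<lambda>t. dird d1 (dird d1 U) (x0 + t *\<^sub>R d1)) (dird d1 (dird d1 U) x0) u111 u1111"
    "jet2 (\<lambda>t. dird d2 (dird d1 U) (x0 + t *\<^sub>R d1)) (dird d2 (dird d1 U) x0) u112 u1112"
    "jet2 (\<lambda>t. dird d2 (dird d2 U) (x0 + t *\<^sub>R d1)) (dird d2 (dird d2 U) x0) u122 u1122"
    "jet2 (\<lambda>t. dird d1 U (x0 + t *\<^sub>R d1)) (dird d1 U x0) (dird d1 (dird d1 U) x0) u111"
    "jet2 (\<lambda>t. dird d2 U (x0 + t *\<^sub>R d1)) (dird d2 U x0) (dird d2 (dird d1 U) x0) u112"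
    "jet2 (\<lambda>t. dird d1 (dird d1 U) (x0 + t *\<^sub>R d2)) (dird d1 (dird d1 U) x0) u112 u1122"
    "jet2 (\<lambda>t. dird d2 (dird d1 U) (x0 + t *\<^sub>R d2)) (dird d2 (dird d1 U) x0) u122 u1222"
    "jet2 (\<lambda>t. dird d2 (dird d2 U) (x0 + t *\<^sub>R d2)) (dird d2 (dird d2 U) x0) u222 u2222"
    "jet2 (\<lambda>t. dird d1 U (x0 + t *\<^sub>R d2)) (dird d1 U x0) (dird d2 (dird d1 U) x0) u122"
    "jet2 (\<lambda>t. dird d2 U (x0 + t *\<^sub>R d2)) (dird d2 U x0) (dird d2 (dird d2 U) x0) u222"
    and F: "dird d1 f x0 = u111 * dird d2 (dird d2 U) x0 + dird d1 (dird d1 U) x0 * u122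
      - 2 * dird d2 (dird d1 U) x0 * u112"
    "dird d2 f x0 = u112 * dird d2 (dird d2 U) x0 + dird d1 (dird d1 U) x0 * u222
      - 2 * dird d2 (dird d1 U) x0 * u122"
    "dird d1 (dird d1 f) x0 = u1111 * dird d2 (dird d2 U) x0 + 2 * u111 * u122
      + dird d1 (dird d1 U) x0 * u1122 - 2 * u112\<^sup>2 - 2 * dird d2 (dird d1 U) x0 * u1112"
    "dird d1 (dird d2 f) x0 = u1112 * dird d2 (dird d2 U) x0 + u112 * u122 + u111 * u222
      + dird d1 (dird d1 U) x0 * u1222 - 2 * u112 * u122 - 2 * dird d2 (dird d1 U) x0 * u1122"
    by (rule frame_jets[OF S U f E0(1) feq])
  have H: "dird d1 (dird d1 U) x0 = la" "dird d2 (dird d1 U) x0 = 0" "dird d2 (dird d2 U) x0 = mu"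
    using Ub[OF E0(1)] E0(5) by (auto simp: la_def mu_def)
  define p q s where "p = (\<lambda>d t. bil u (x0 + t *\<^sub>R d) t0 t0)" and "q = (\<lambda>d t. bil u (x0 + t *\<^sub>R d) t0 (rot t0))"
    and "s = (\<lambda>d t. bil u (x0 + t *\<^sub>R d) (rot t0) (rot t0))"
  define v1 v2 where "v1 = (\<lambda>d t. 1 / r * dird t0 u (x0 + t *\<^sub>R d))"
    and "v2 = (\<lambda>d t. 1 / r * dird (rot t0) u (x0 + t *\<^sub>R d))"
  define w1 w2 where "w1 = 1 / r * dird t0 u x0" and "w2 = 1 / r * dird (rot t0) u x0"
  have W: "dird d1 U x0 = w1" "dird d2 U x0 = w2" using Ub[OF E0(1)] by (simp_all add: w1_def w2_def)
  have "\<forall>\<^sub>F t in nhds 0. dird d1 (dird d1 U) (x0 + t *\<^sub>R d) = p d t"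
    "\<forall>\<^sub>F t in nhds 0. dird d2 (dird d1 U) (x0 + t *\<^sub>R d) = q d t"
    "\<forall>\<^sub>F t in nhds 0. dird d2 (dird d2 U) (x0 + t *\<^sub>R d) = s d t"
    "\<forall>\<^sub>F t in nhds 0. dird d1 U (x0 + t *\<^sub>R d) = v1 d t"
    "\<forall>\<^sub>F t in nhds 0. dird d2 U (x0 + t *\<^sub>R d) = v2 d t" for d
    unfolding p_def q_def s_def v1_def v2_def
    by (intro eventually_mono[OF in_ball[of d]] Ub; assumption)+
  note cong = jet2_cong[OF _ this(1)] jet2_cong[OF _ this(2)] jet2_cong[OF _ this(3)]
    jet2_cong[OF _ this(4)] jet2_cong[OF _ this(5)]
  have j1: "jet2 (p d1) la u111 u1111" "jet2 (q d1) 0 u112 u1112" "jet2 (s d1) mu u122 u1122"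
    "jet2 (v1 d1) w1 la u111" "jet2 (v2 d1) w2 0 u112"
    using cong(1)[OF J(1)] cong(2)[OF J(2)] cong(3)[OF J(3)] cong(4)[OF J(4)] cong(5)[OF J(5)]
    unfolding H W by simp_all
  have j2: "jet2 (p d2) la u112 u1122" "jet2 (q d2) 0 u122 u1222" "jet2 (s d2) mu u222 u2222"
    "jet2 (v1 d2) w1 0 u122" "jet2 (v2 d2) w2 mu u222"
    using cong(1)[OF J(6)] cong(2)[OF J(7)] cong(3)[OF J(8)] cong(4)[OF J(9)] cong(5)[OF J(10)]
    unfolding H W by simp_all
  define P where "P = (\<lambda>d k1 k2. test_fun c (p d) (q d) (s d) (v1 d) (v2 d) X1 k1 X2 k2)"
  \<comment> \<open>Stated for a general direction, then used for both frame vectors. Maximality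
    over \<open>E\<close> is transported along the curve of rotated pairs.\<close>
  have loc: "\<forall>\<^sub>F \<sigma> in nhds 0. P d k1 k2 \<sigma> \<le> P d k1 k2 0"
    if d: "d = k1 *\<^sub>R (r *\<^sub>R t0) + k2 *\<^sub>R (r *\<^sub>R rot t0)"
      and j: "jet2 (p d) la p1 p2" "jet2 (q d) 0 q1 q2" "jet2 (s d) mu s1 s2"
    for d k1 k2 p1 p2 q1 q2 s1 s2
  proof -
    define th where "th = eig_angle (p d) (q d) (s d)"
    define y1 y2 where "y1 = (\<lambda>t. (X1 + k1 * t) * cos (th t) + (X2 + k2 * t) * sin (th t))"
      and "y2 = (\<lambda>t. (X2 + k2 * t) * cos (th t) - (X1 + k1 * t) * sin (th t))"
    define tau where "tau = (\<lambda>t. cos (th t) *\<^sub>R t0 + sin (th t) *\<^sub>R rot t0)"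
    note key = test_fun_eq_ln_weight[OF r0 E0(2) d p_def[THEN fun_cong, of d] q_def[THEN fun_cong, of d]
        s_def[THEN fun_cong, of d] v1_def[THEN fun_cong, of d] v2_def[THEN fun_cong, of d]
        X1_def X2_def th_def y1_def y2_def tau_def]
    note jth = jet2_eig_angle[OF j mula, folded th_def]
    note jy = jet2_rotated_coordinates[OF jth]
    have ty: "(y1 \<longlongrightarrow> X1) (nhds 0)" "(y2 \<longlongrightarrow> X2) (nhds 0)"
      unfolding y1_def y2_def using jet2_tendsto[OF jy(1)] jet2_tendsto[OF jy(2)] by blast+
    have tw: "(eig_val (p d) (q d) (s d) \<longlongrightarrow> la) (nhds 0)"
      using jet2_tendsto[OF jet2_eigenvalue[OF j mula]] unfolding eig_val_def[abs_def] .
    have tps: "((\<lambda>t. p d t - s d t) \<longlongrightarrow> la - mu) (nhds 0)"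
      using jet2_tendsto[OF j(1)] jet2_tendsto[OF j(3)] by (rule tendsto_diff)
    \<comment> \<open>Besides the domain, strict inequalities valid at 0, hence by continuity for
      all small \<open>t\<close>; they place the curve in \<open>E\<close>.\<close>
    define good where "good t \<longleftrightarrow> x0 + t *\<^sub>R d \<in> ball 0 R \<and> s d t < p d t \<and> \<bar>y1 t\<bar> < 1 \<and> \<bar>y2 t\<bar> < 1
      \<and> 500 * G\<^sup>2 \<le> eig_val (p d) (q d) (s d) t" for t
    have "\<forall>\<^sub>F t in nhds 0. \<bar>y1 t\<bar> < 1" "\<forall>\<^sub>F t in nhds 0. \<bar>y2 t\<bar> < 1"
      using order_tendstoD(2)[OF tendsto_rabs[OF ty(1)] X(1)] order_tendstoD(2)[OF tendsto_rabs[OF ty(2)] X(2)] by auto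
    moreover have "\<forall>\<^sub>F t in nhds 0. 500 * G\<^sup>2 < eig_val (p d) (q d) (s d) t"
      by (rule order_tendstoD(1)[OF tw]) (use la_G G2 in linarith)
    moreover have "\<forall>\<^sub>F t in nhds 0. 0 < p d t - s d t"
      by (rule order_tendstoD(1)[OF tps]) (use mula in simp)
    ultimately have ev: "\<forall>\<^sub>F t in nhds 0. good t"
      using in_ball[of d] by eventually_elim (auto simp: good_def)
    have Pw: "(x0 + t *\<^sub>R d, tau t) \<in> E" "0 < weight u r c (x0 + t *\<^sub>R d) (tau t)"
      "P d k1 k2 t = ln (weight u r c (x0 + t *\<^sub>R d) (tau t))" if "good t" for t
    proof -
      have L: "0 < 500 * G\<^sup>2" using G2 by linarith
      note g = that[unfolded good_def]
      show "(x0 + t *\<^sub>R d, tau t) \<in> E" unfolding E_def by (rule key(1)) (use g L in blast)+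
      show "0 < weight u r c (x0 + t *\<^sub>R d) (tau t)" by (rule key(2)[where L = "500 * G\<^sup>2"]) (use g L in blast)+
      show "P d k1 k2 t = ln (weight u r c (x0 + t *\<^sub>R d) (tau t))"
        unfolding P_def by (rule key(3)[where L = "500 * G\<^sup>2"]) (use g L in blast)+
    qed
    have "th 0 = 0" using jet2_value[OF jth] .
    then have tau0: "tau 0 = t0" by (simp add: tau_def)
    have g0: "good 0" using eventually_nhds_x_imp_x[OF ev] .
    show ?thesis
      using ev
    proof eventually_elim
      case (elim t)
      have "weight u r c (x0 + t *\<^sub>R d) (tau t) \<le> weight u r c x0 t0"
        by (rule max[OF Pw(1)[OF elim]])
      then show ?case using Pw[OF elim] Pw[OF g0] tau0 by simp
    qed
  qed
  have l1: "\<forall>\<^sub>F \<sigma> in nhds 0. P d1 1 0 \<sigma> \<le> P d1 1 0 0" by (rule loc[OF _ j1(1-3)]) (simp add: d1_def)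
  have l2: "\<forall>\<^sub>F \<sigma> in nhds 0. P d2 0 1 \<sigma> \<le> P d2 0 1 0" by (rule loc[OF _ j2(1-3)]) (simp add: d2_def)
  define D a a2 b b2 where "D = la - mu" and "a = - 4 * X1 / (1 - X1\<^sup>2)" and "a2 = - 4 * (1 + X1\<^sup>2) / (1 - X1\<^sup>2)\<^sup>2"
    and "b = - 4 * X2 / (1 - X2\<^sup>2)" and "b2 = - 4 * (1 + X2\<^sup>2) / (1 - X2\<^sup>2)\<^sup>2"
  have lapos: "0 < la" using la0 by simp
  note tf1 = jet2_test_fun[OF j1(1-3) mula lapos j1(4,5) X D_def refl refl a_def a2_def b_def b2_def,
      of c 1 0]
  note tf2 = jet2_test_fun[OF j2(1-3) mula lapos j2(4,5) X D_def refl refl a_def a2_def b_def b2_def,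
      of c 0 1]
  note m1 = jet2_local_max[OF tf1 l1[unfolded P_def]]
  note m2 = jet2_local_max[OF tf2 l2[unfolded P_def]]
  note cb1 = cutoff_bounds[OF X(1) z(2)[unfolded h1_def], folded a_def a2_def]
  note cb2 = cutoff_bounds[OF X(2) z(3)[unfolded h2_def], folded b_def b2_def]
  have fd: "\<bar>dird d1 f x0\<bar> \<le> G" "\<bar>dird d2 f x0\<bar> \<le> G"
  proof -
    have "\<bar>dird (r *\<^sub>R e) f x0\<bar> \<le> G" if "norm e = 1" for e
    proof -
      have "\<bar>dird (r *\<^sub>R e) f x0\<bar> = r * \<bar>grad f x0 \<bullet> e\<bar>" using r0 by (simp add: dird_eq_grad abs_mult)
      also have "\<dots> \<le> r * norm (grad f x0)"
        using r0 Cauchy_Schwarz_ineq2[of "grad f x0" e] that by (intro mult_left_mono) auto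
      finally show ?thesis using f1[OF E0(1)] by linarith
    qed
    then show "\<bar>dird d1 f x0\<bar> \<le> G" "\<bar>dird d2 f x0\<bar> \<le> G" using E0(2) nrot by (auto simp: d1_def d2_def)
  qed
  have fdd: "\<bar>dird d1 (dird d1 f) x0\<bar> \<le> G" "\<bar>dird d1 (dird d2 f) x0\<bar> \<le> G"
  proof -
    have "\<bar>dird (r *\<^sub>R e) (dird (r *\<^sub>R e') f) x0\<bar> \<le> G" if "norm e = 1" "norm e' = 1" for e e'
    proof -
      have "\<bar>dird (r *\<^sub>R e) (dird (r *\<^sub>R e') f) x0\<bar> = r\<^sup>2 * \<bar>bil f x0 e e'\<bar>"
        using r0 by (simp add: dird_dird[OF S f2' E0(1)] bil_scaleR abs_mult power2_eq_square)
      also have "\<dots> \<le> r\<^sup>2 * mat_norm (hess f x0)"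
        using abs_bil_le_mat_norm[OF S f2' E0(1) that] by (intro mult_left_mono) auto
      finally show ?thesis using f2[OF E0(1)] by linarith
    qed
    then show "\<bar>dird d1 (dird d1 f) x0\<bar> \<le> G" "\<bar>dird d1 (dird d2 f) x0\<bar> \<le> G"
      using E0(2) nrot by (auto simp: d1_def d2_def)
  qed
  have cw: "\<bar>c * w1\<bar> \<le> G" "\<bar>c * w2\<bar> \<le> G"
  proof -
    have "\<bar>c * (1 / r * dird e u x0)\<bar> \<le> G" if "norm e = 1" for e
    proof -
      have "\<bar>grad u x0 \<bullet> e\<bar> \<le> r * K"
        using Cauchy_Schwarz_ineq2[of "grad u x0" e] that uK[OF E0(1)] by simp
      then have "\<bar>1 / r * dird e u x0\<bar> \<le> K" using r0 by (simp add: dird_eq_grad abs_mult field_simps)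
      then have "c * \<bar>1 / r * dird e u x0\<bar> \<le> c * K" using c by (intro mult_left_mono) auto
      then have "\<bar>c * (1 / r * dird e u x0)\<bar> \<le> c * K" using c by (simp only: abs_mult abs_of_pos)
      then show ?thesis using G(2) by (simp add: c_def)
    qed
    then show "\<bar>c * w1\<bar> \<le> G" "\<bar>c * w2\<bar> \<le> G" using E0(2) nrot by (auto simp: w1_def w2_def)
  qed
  have cf: "5 \<le> c * f x0" using fm[OF E0(1)] m by (simp add: c_def field_simps)
  show False
  proof (rule no_critical_jet[OF G(1) z(1) la_z lamu f0 fd fdd cw cf _ _ _ cb1(1) cb2(1) cb1(2) cb2(2,3) cb1(4) cb2(4) D_def])
    show "dird d1 f x0 = mu * u111 + la * u122" "dird d2 f x0 = mu * u112 + la * u222"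
      using F(1,2) H by (simp_all add: algebra_simps)
    show "dird d1 (dird d1 f) x0 = mu * u1111 + 2 * u111 * u122 + la * u1122 - 2 * u112\<^sup>2"
      using F(3) H by (simp add: algebra_simps)
    show "dird d1 (dird d2 f) x0 = mu * u1112 + u111 * u222 + la * u1222 - u112 * u122"
      using F(4) H by (simp add: algebra_simps)
    show "u111 / la + a * (1 + X2 * (u112 / D)) + b * (- X1 * (u112 / D)) + c * (w1 * la) = 0"
      using m1(1) by simp
    show "u112 / la + a * (X2 * (u122 / D)) + b * (1 - X1 * (u122 / D)) + c * (w2 * mu) = 0"
      using m2(1) by simp
    show "(u1111 + 2 * u112\<^sup>2 / D) / la - (u111 / la)\<^sup>2
      + (a2 * (1 + X2 * (u112 / D))\<^sup>2 + a * (X2 * (u1112 / D - 2 * u112 * (u111 - u122) / D\<^sup>2) - X1 * (u112 / D)\<^sup>2))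
      + (b2 * (- X1 * (u112 / D))\<^sup>2 + b * (- 2 * (u112 / D) - X1 * (u1112 / D - 2 * u112 * (u111 - u122) / D\<^sup>2) - X2 * (u112 / D)\<^sup>2))
      + c * (la\<^sup>2 + w1 * u111 + w2 * u112) \<le> 0"
      using m1(2) by (simp add: add.assoc)
    show "(u1122 + 2 * u122\<^sup>2 / D) / la - (u112 / la)\<^sup>2
      + (a2 * (X2 * (u122 / D))\<^sup>2 + a * (2 * (u122 / D) + X2 * (u1222 / D - 2 * u122 * (u112 - u222) / D\<^sup>2) - X1 * (u122 / D)\<^sup>2))
      + (b2 * (1 - X1 * (u122 / D))\<^sup>2 + b * (- X1 * (u1222 / D - 2 * u122 * (u112 - u222) / D\<^sup>2) - X2 * (u122 / D)\<^sup>2))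
      + c * (mu\<^sup>2 + w1 * u122 + w2 * u222) \<le> 0"
      using m2(2) by (simp add: add.assoc add.left_commute)
  qed (use X c in auto)
qed

section \<open>From the top eigenvalue at the origin to the operator norm\<close>

text \<open>Midpoint convexity makes \<open>- u (t e) - u (- t e)\<close> maximal at
  \<open>t = 0\<close>, so the second derivative test applies to this even function.\<close>

lemma convex_imp_bil_nonneg:
  assumes R: "0 < R" and u: "Ck_on (Suc (Suc k)) (ball 0 R) u" and conv: "convex_on (ball 0 R) u"
  shows "0 \<le> bil u 0 e e"
proof -
  have S: "open (ball (0::real^2) R)" and 0: "(0::real^2) \<in> ball 0 R" using R by auto
  note j = jet2_along_line[OF S u 0, unfolded dird_dird[OF S u 0]]
  have "jet2 (\<lambda>t. - 1 * (u (0 + t *\<^sub>R e) + u (0 + t *\<^sub>R (- 1 *\<^sub>R e)))) (- 1 * (u 0 + u 0))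
      (- 1 * (dird e u 0 + dird (- 1 *\<^sub>R e) u 0)) (- 1 * (bil u 0 e e + bil u 0 (- 1 *\<^sub>R e) (- 1 *\<^sub>R e)))"
    by (intro jet2_cmult jet2_add j)
  moreover have "\<forall>\<^sub>F t in nhds 0. - 1 * (u (0 + t *\<^sub>R e) + u (0 + t *\<^sub>R (- 1 *\<^sub>R e)))
      \<le> - 1 * (u (0 + 0 *\<^sub>R e) + u (0 + 0 *\<^sub>R (- 1 *\<^sub>R e)))"
    using eventually_line_in_open[OF S 0, of e] eventually_line_in_open[OF S 0, of "- 1 *\<^sub>R e"]
  proof eventually_elim
    case (elim t)
    have "u ((1 - 1 / 2) *\<^sub>R (t *\<^sub>R e) + (1 / 2) *\<^sub>R (t *\<^sub>R (- 1 *\<^sub>R e)))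
      \<le> (1 - 1 / 2) * u (t *\<^sub>R e) + 1 / 2 * u (t *\<^sub>R (- 1 *\<^sub>R e))"
      using elim by (intro convex_onD[OF conv]) auto
    then show ?case by (simp add: field_simps)
  qed
  ultimately have "- 1 * (bil u 0 e e + bil u 0 (- 1 *\<^sub>R e) (- 1 *\<^sub>R e)) \<le> 0"
    by (rule jet2_local_max(2))
  then show ?thesis by (simp only: bil_scaleR) simp
qed

text \<open>A symmetric 2 by 2 matrix plus its adjugate is the trace times the identity. Squaring
  gives \<open>|A h|^2 = (tr A)^2 |h|^2 - |adj A h|^2 - 2 det A |h|^2\<close>, and the last two
  terms are nonpositive.\<close>

lemma mat_norm_hess_le_trace:
  assumes "open S" "Ck_on (Suc (Suc k)) S u" "x \<in> S"
    and nonneg: "\<And>e. 0 \<le> bil u x e e" and det: "0 \<le> det (hess u x)"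
  shows "mat_norm (hess u x) \<le> pd 1 (pd 1 u) x + pd 2 (pd 2 u) x"
  unfolding mat_norm_def
proof (rule onorm_le)
  fix h :: "real^2"
  define a b c where "a = pd 1 (pd 1 u) x" and "b = pd 2 (pd 1 u) x" and "c = pd 2 (pd 2 u) x"
  have b': "pd 1 (pd 2 u) x = b" using pd_commute[OF assms(1-3), of 1 2] by (simp add: b_def)
  have "0 \<le> a" using nonneg[of "axis 1 1"] by (simp add: bil_def axis_def a_def)
  moreover have "0 \<le> c" using nonneg[of "axis 2 1"] by (simp add: bil_def axis_def c_def)
  moreover have ac: "0 \<le> a * c - b\<^sup>2"
    using det by (simp add: det_2 hess_def a_def c_def b' b_def[symmetric] power2_eq_square)
  ultimately have tr: "0 \<le> a + c" by simp
  have "(norm (hess u x *v h))\<^sup>2 = (a * h $ 1 + b * h $ 2)\<^sup>2 + (b * h $ 1 + c * h $ 2)\<^sup>2"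
    unfolding norm_real2 by (simp add: matrix_vector_mult_def sum_2 hess_def a_def c_def b' b_def[symmetric])
  also have "\<dots> = ((a + c) * norm h)\<^sup>2 - (c * h $ 1 - b * h $ 2)\<^sup>2 - (a * h $ 2 - b * h $ 1)\<^sup>2
      - 2 * (a * c - b\<^sup>2) * (norm h)\<^sup>2"
    unfolding power_mult_distrib norm_real2 by (simp add: power2_eq_square algebra_simps)
  also have "\<dots> \<le> ((a + c) * norm h)\<^sup>2"
  proof -
    have "0 \<le> 2 * (a * c - b\<^sup>2) * (norm h)\<^sup>2" using ac by (intro mult_nonneg_nonneg) auto
    then show ?thesis
      using zero_le_power2[of "c * h $ 1 - b * h $ 2"] zero_le_power2[of "a * h $ 2 - b * h $ 1"] by linarith
  qed
  finally have "(norm (hess u x *v h))\<^sup>2 \<le> ((a + c) * norm h)\<^sup>2" .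
  then show "norm (hess u x *v h) \<le> (pd 1 (pd 1 u) x + pd 2 (pd 2 u) x) * norm h"
    unfolding a_def[symmetric] c_def[symmetric] by (rule power2_le_imp_le) (simp add: tr)
qed

text \<open>The direction is half the argument of the complex number with real part
  \<open>a - c\<close> and imaginary part \<open>2 * b\<close>; twice the form there is the trace
  plus the modulus. If that number is 0 both identities in \<open>z\<close> still hold, so no case
  distinction arises.\<close>

lemma exists_eigenvector:
  obtains t :: "real^2" where "norm t = 1" "bil u x t (rot t) = 0"
    "pd 1 (pd 1 u) x + pd 2 (pd 2 u) x \<le> 2 * bil u x t t"
proof -
  define a b c where "a = pd 1 (pd 1 u) x" and "b = pd 2 (pd 1 u) x" and "c = pd 2 (pd 2 u) x"
  define z where "z = Complex (a - c) (2 * b)"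
  define D al where "D = cmod z" and "al = Arg z"
  have z: "a - c = D * cos al" "2 * b = D * sin al"
    using rcis_cmod_Arg[of z] by (auto simp: z_def complex_eq_iff D_def al_def)
  define C S where "C = cos (al / 2)" and "S = sin (al / 2)"
  have CS: "C\<^sup>2 + S\<^sup>2 = 1" by (simp add: C_def S_def)
  have dbl: "sin al = 2 * S * C" "cos al = C\<^sup>2 - S\<^sup>2"
    using sin_double[of "al / 2"] cos_double[of "al / 2"] by (simp_all add: C_def S_def)
  define t :: "real^2" where "t = vector [C, S]"
  have t: "t $ 1 = C" "t $ 2 = S" by (simp_all add: t_def)
  have "(norm t)\<^sup>2 = 1" unfolding norm_real2 t by (rule CS)
  then have "norm t = 1" using norm_ge_zero[of t] by (auto simp: power2_eq_1_iff)
  moreover have "2 * bil u x t (rot t) = 2 * b * (C\<^sup>2 - S\<^sup>2) - (a - c) * (2 * S * C)"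
    unfolding bil_def rot_nth t a_def b_def c_def by (simp add: algebra_simps power2_eq_square)
  then have "bil u x t (rot t) = 0" using z dbl by simp
  moreover have "2 * bil u x t t = (C\<^sup>2 + S\<^sup>2) * (a + c) + (a - c) * (C\<^sup>2 - S\<^sup>2) + 2 * b * (2 * S * C)"
    unfolding bil_def t a_def b_def c_def by (simp add: algebra_simps power2_eq_square)
  then have "2 * bil u x t t = a + c + (D * (cos al)\<^sup>2 + D * (sin al)\<^sup>2)"
    unfolding z CS dbl[symmetric] by (simp add: power2_eq_square)
  then have "a + c \<le> 2 * bil u x t t" by (simp add: D_def)
  ultimately show ?thesis using that unfolding a_def c_def by blast
qed

section \<open>The constants and the final estimate\<close>

theorem theorem1p1:
  shows "\<exists>(C2::real \<Rightarrow> real \<Rightarrow> real) (C1::real \<Rightarrow> real \<Rightarrow> real \<Rightarrow> real \<Rightarrow> real).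
    (\<forall>m M. 0 < m \<and> m \<le> M \<longrightarrow> 0 < C2 m M \<and> (\<forall>a b. 0 < C1 m M a b)) \<and>
    (\<forall>(R::real) (u::real^2 \<Rightarrow> real) (f::real^2 \<Rightarrow> real) (m::real) (M::real).
       0 < R \<and> 0 < m \<and> m \<le> M \<and>
       Ck_on 4 (ball 0 R) u \<and> convex_on (ball 0 R) u \<and>
       Ck_on 2 (ball 0 R) f \<and>
       (\<forall>x\<in>ball 0 R. det (hess u x) = f x) \<and>
       (\<forall>x\<in>ball 0 R. m \<le> f x \<and> f x \<le> M) \<and>
       bdd_above ((\<lambda>x. norm (grad u x)) ` ball 0 R) \<and>
       bdd_above ((\<lambda>x. norm (grad f x)) ` ball 0 R) \<and>
       bdd_above ((\<lambda>x. mat_norm (hess f x)) ` ball 0 R)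
       \<longrightarrow>
       mat_norm (hess u 0)
         \<le> C1 m M (R * (SUP x\<in>ball 0 R. norm (grad f x)))
                   (R\<^sup>2 * (SUP x\<in>ball 0 R. mat_norm (hess f x)))
           * exp (C2 m M * (SUP x\<in>ball 0 R. (norm (grad u x))\<^sup>2) / R\<^sup>2))"
proof -
  \<comment> \<open>With \<open>K^2 = 4 * s / R^2\<close> the final exponent
    \<open>(1 + 5 / (2 * m)) * K^2\<close> equals \<open>(4 + 10 / m) * s / R^2\<close>. The 4000 in
    \<open>C1\<close> is 1000 from \<open>eigenvalue_estimate\<close>, a factor 2 from absorbing
    \<open>(1 + K)^2\<close> and a factor 2 from bounding the trace by twice the eigenvalue.\<close>
  define C2 :: "real \<Rightarrow> real \<Rightarrow> real" where "C2 = (\<lambda>m M. 4 + 10 / m)"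
  define g0 :: "real \<Rightarrow> real \<Rightarrow> real \<Rightarrow> real \<Rightarrow> real"
    where "g0 = (\<lambda>m M a b. 1 + M + \<bar>a\<bar> + \<bar>b\<bar> + 5 / m)"
  define C1 :: "real \<Rightarrow> real \<Rightarrow> real \<Rightarrow> real \<Rightarrow> real" where "C1 = (\<lambda>m M a b. 4000 * (g0 m M a b)\<^sup>2)"
  have g0_pos: "1 \<le> g0 m M a b" if "0 < m" "m \<le> M" for m M a b
    using that unfolding g0_def by simp
  have "0 < C2 m M" "0 < C1 m M a b" if "0 < m" "m \<le> M" for m M a b
    using that g0_pos[OF that, of a b] by (auto simp: C2_def C1_def add_pos_pos)
  moreover have "mat_norm (hess u 0)
      \<le> C1 m M (R * (SUP x\<in>ball 0 R. norm (grad f x))) (R\<^sup>2 * (SUP x\<in>ball 0 R. mat_norm (hess f x)))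
           * exp (C2 m M * (SUP x\<in>ball 0 R. (norm (grad u x))\<^sup>2) / R\<^sup>2)"
    if R: "0 < R" and m: "0 < m" "m \<le> M" and u: "Ck_on 4 (ball 0 R) u" and conv: "convex_on (ball 0 R) u"
      and f: "Ck_on 2 (ball 0 R) f" and det: "\<forall>x\<in>ball 0 R. det (hess u x) = f x"
      and fb: "\<forall>x\<in>ball 0 R. m \<le> f x \<and> f x \<le> M"
      and bu: "bdd_above ((\<lambda>x. norm (grad u x)) ` ball 0 R)"
      and bf: "bdd_above ((\<lambda>x. norm (grad f x)) ` ball 0 R)"
      and bff: "bdd_above ((\<lambda>x. mat_norm (hess f x)) ` ball 0 R)"
    for R m M :: real and u f :: "real^2 \<Rightarrow> real"
  proof -
    define s a b where "s = (SUP x\<in>ball 0 R. (norm (grad u x))\<^sup>2)"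
      and "a = R * (SUP x\<in>ball 0 R. norm (grad f x))"
      and "b = R\<^sup>2 * (SUP x\<in>ball 0 R. mat_norm (hess f x))"
    have S: "open (ball (0::real^2) R)" and 0: "(0::real^2) \<in> ball 0 R" using R by auto
    have u2: "Ck_on (Suc (Suc 2)) (ball 0 R) u" using u by (simp add: eval_nat_numeral)
    obtain B where B: "\<And>x. x \<in> ball 0 R \<Longrightarrow> norm (grad u x) \<le> B" using bu unfolding bdd_above_def by blast
    have "bdd_above ((\<lambda>x. (norm (grad u x))\<^sup>2) ` ball 0 R)"
      using B by (intro bdd_aboveI2[where M = "B\<^sup>2"] power_mono) auto
    then have us: "(norm (grad u x))\<^sup>2 \<le> s" if "x \<in> ball 0 R" for x
      unfolding s_def using that by (intro cSUP_upper)
    have s0: "0 \<le> s" using us[OF 0] zero_le_power2[of "norm (grad u 0)"] by linarith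
    \<comment> \<open>\<open>K\<close> is chosen so that \<open>r * K = sqrt s\<close>.
      \<open>G\<close> has to dominate \<open>5 / m * K\<close> as well as the data of
      \<open>f\<close>, hence its factor \<open>1 + K\<close>.\<close>
    define r K where "r = R / 2" and "K = 2 * sqrt s / R"
    define G where "G = g0 m M a b * (1 + K)"
    have K: "0 \<le> K" using s0 R by (simp add: K_def)
    have g: "1 \<le> g0 m M a b" by (rule g0_pos[OF m])
    have gG: "g0 m M a b \<le> G" "g0 m M a b * K \<le> G"
      unfolding G_def using g K by (auto simp: algebra_simps)
    have g_le: "M \<le> g0 m M a b" "\<bar>a\<bar> \<le> g0 m M a b" "\<bar>b\<bar> \<le> g0 m M a b" "5 / m \<le> g0 m M a b"
      using m by (auto simp: g0_def)
    obtain t where t: "norm t = 1" "bil u 0 t (rot t) = 0"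
      "pd 1 (pd 1 u) 0 + pd 2 (pd 2 u) 0 \<le> 2 * bil u 0 t t"
      by (rule exists_eigenvector)
    have L: "bil u 0 t t \<le> 1000 * G\<^sup>2 * exp (5 / m / 2 * K\<^sup>2)"
    proof (rule eigenvalue_estimate[OF R u f _ m(1) _ _ r_def])
      fix x :: "real^2" assume x: "x \<in> ball 0 R"
      show "det (hess u x) = f x" "m \<le> f x" using det fb x by auto
      show "f x \<le> G" using fb x g_le(1) gG(1) by fastforce
      have "norm (grad u x) \<le> sqrt s" using us[OF x] by (rule real_le_rsqrt)
      then show "norm (grad u x) \<le> r * K" using R by (simp add: r_def K_def)
      have "r * norm (grad f x) \<le> R * (SUP x\<in>ball 0 R. norm (grad f x))"
        using R x bf by (intro mult_mono cSUP_upper) (auto simp: r_def)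
      then show "r * norm (grad f x) \<le> G" using g_le(2) gG(1) unfolding a_def[symmetric] by linarith
      have "0 \<le> mat_norm (hess f x)"
        unfolding mat_norm_def by (intro onorm_pos_le matrix_vector_mul_bounded_linear)
      then have "r\<^sup>2 * mat_norm (hess f x) \<le> R\<^sup>2 * (SUP x\<in>ball 0 R. mat_norm (hess f x))"
        using R x bff by (intro mult_mono cSUP_upper power_mono) (auto simp: r_def)
      then show "r\<^sup>2 * mat_norm (hess f x) \<le> G" using g_le(3) gG(1) unfolding b_def[symmetric] by linarith
    next
      show "1 \<le> G" using g gG by linarith
      have "5 / m * K \<le> g0 m M a b * K" using g_le(4) K by (rule mult_right_mono)
      then show "5 / m * K \<le> G" using gG(2) by linarith
    qed (rule t(1), rule t(2))
    \<comment> \<open>The polynomial dependence of \<open>G\<close> on the gradient must not reach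
      \<open>C1\<close>; it is moved into the exponential.\<close>
    have "(1 + K)\<^sup>2 = 2 * (1 + K\<^sup>2) - (1 - K)\<^sup>2" by (simp add: power2_eq_square algebra_simps)
    also have "\<dots> \<le> 2 * (1 + K\<^sup>2)" by simp
    also have "\<dots> \<le> 2 * exp (K\<^sup>2)" by (intro mult_left_mono exp_ge_add_one_self) simp
    finally have "G\<^sup>2 \<le> (g0 m M a b)\<^sup>2 * (2 * exp (K\<^sup>2))"
      unfolding G_def power_mult_distrib by (intro mult_left_mono) auto
    then have "1000 * G\<^sup>2 * exp (5 / m / 2 * K\<^sup>2)
        \<le> 1000 * ((g0 m M a b)\<^sup>2 * (2 * exp (K\<^sup>2))) * exp (5 / m / 2 * K\<^sup>2)"
      by (intro mult_right_mono mult_left_mono) auto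
    also have "\<dots> = 2000 * (g0 m M a b)\<^sup>2 * exp (K\<^sup>2 + 5 / m / 2 * K\<^sup>2)"
      by (simp add: exp_add)
    also have "K\<^sup>2 + 5 / m / 2 * K\<^sup>2 = C2 m M * s / R\<^sup>2"
      using s0 by (simp add: K_def C2_def power_divide power_mult_distrib algebra_simps add_divide_distrib)
    finally have L': "2 * bil u 0 t t \<le> C1 m M a b * exp (C2 m M * s / R\<^sup>2)"
      using L unfolding C1_def by simp
    have "0 \<le> det (hess u 0)" using det fb 0 m by fastforce
    then have "mat_norm (hess u 0) \<le> pd 1 (pd 1 u) 0 + pd 2 (pd 2 u) 0"
      using mat_norm_hess_le_trace[OF S u2 0 convex_imp_bil_nonneg[OF R u2 conv]] by blast
    then show ?thesis using t(3) L' unfolding a_def b_def s_def by linarith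
  qed
  ultimately show ?thesis
    by (intro exI[of _ C2] exI[of _ C1]) auto
qed

end
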